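(* Let $n\ge0$ be an integer and let $c,d$ be complex parameters for which all the series and Gamma factors below are defined and the series converge. Then \begin{align*} &{}_6F_5\biggl[\begin{matrix} 3n+1, \, \frac{3n}2+\frac32, \, n+\frac12, \, n+1, \, c, \, d \\[2pt] \frac{3n}2+\frac12, \, 2n+\frac32, \, 2n+1, \, 3n+2-c, \, 3n+2-d \end{matrix}\,; -1\biggr] \\ &\quad =\frac{\Gamma(4n+3)\,\Gamma(3n+2-c)\,\Gamma(3n+2-d)\,\Gamma(4n+3-c-d)}{\Gamma(3n+2)\,\Gamma(4n+3-c)\,\Gamma(4n+3-d)\,\Gamma(3n+2-c-d)} \\ &\quad\qquad\times {}_6F_5\biggl[\begin{matrix} 2n+1, \, n+\frac32, \, \frac c2, \, \frac c2+\frac12, \, \frac d2, \, \frac d2+\frac12 \\[2pt] n+\frac12, \, 2n+2-\frac c2, \, 2n+\frac32-\frac c2, \, 2n+2-\frac d2, \, 2n+\frac32-\frac d2 \end{matrix}; 1\biggr]. \end{align*}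
   Context: The generalized hypergeometric series is ${}_pF_q\Bigl[\begin{matrix}a_1,\dots,a_p\\ b_1,\dots,b_q\end{matrix};z\Bigr]=\sum_{k\ge0}\frac{(a_1)_k\cdots(a_p)_k}{(b_1)_k\cdots(b_q)_k}\frac{z^k}{k!}$, where $(a)_k=a(a+1)\cdots(a+k-1)$ is the Pochhammer symbol; $\Gamma$ is Euler's Gamma function. *)

theory Defs
  imports "HOL-Analysis.Analysis"
begin

text \<open>
  The library constant \<^const>\<open>fps_hypergeo\<close> is the formal generalized hypergeometric
  series; its last argument rescales the variable and is 1 here.
\<close>

definition hypergeom_term :: "complex list \<Rightarrow> complex list \<Rightarrow> complex \<Rightarrow> nat \<Rightarrow> complex" where
  "hypergeom_term as bs z k = fps_nth (fps_hypergeo as bs 1) k * z ^ k"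

definition hypergeom :: "complex list \<Rightarrow> complex list \<Rightarrow> complex \<Rightarrow> complex" where
  "hypergeom as bs z = (\<Sum>k. hypergeom_term as bs z k)"

text \<open>
  No lower parameter is a nonpositive integer (so no denominator vanishes), and the partial
  sums converge. Convergence may be conditional, which does occur at \<open>z = -1\<close>.
\<close>

definition hypergeom_convergent :: "complex list \<Rightarrow> complex list \<Rightarrow> complex \<Rightarrow> bool" where
  "hypergeom_convergent as bs z \<longleftrightarrow>
     (\<forall>b\<in>set bs. b \<notin> \<int>\<^sub>\<le>\<^sub>0) \<and> summable (hypergeom_term as bs z)"

lemma foldl_mult_eq_prod_list:
  "foldl (\<lambda>r x. r * f x) y xs = y * (\<Prod>x\<leftarrow>xs. f x)" for y :: "'a :: comm_monoid_mult"
  by (induction xs arbitrary: y) (simp_all add: mult.assoc)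

lemma hypergeom_term_altdef:
  "hypergeom_term as bs z k =
     (\<Prod>a\<leftarrow>as. pochhammer a k) / (\<Prod>b\<leftarrow>bs. pochhammer b k) * (z ^ k / fact k)"
  by (simp add: hypergeom_term_def foldl_mult_eq_prod_list)

lemma hypergeom_eq_eval_fps: "hypergeom as bs z = eval_fps (fps_hypergeo as bs 1) z"
  by (simp add: hypergeom_def hypergeom_term_def eval_fps_def)

end

theory Submission
  imports Defs "HOL-Real_Asymp.Real_Asymp"
begin

text \<open>
  Both sides equal, up to a Gamma factor, the series
  \<open>X = (\<Sum>L. (c)_L (d)_L \<beta>_L)\<close> with
  \<open>\<beta>_L = (n + 1/2)_L / (L! (2n + 1)_L (2n + 3/2)_L)\<close>.
  Indeed Bailey's transform turns \<open>\<Sum>r. \<alpha>_r (c)_r (d)_r / ((a+1-c)_r (a+1-d)_r)\<close> into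
  \<open>\<Sum>L. (c)_L (d)_L \<beta>_L\<close> whenever
  \<open>\<beta>_L = (\<Sum>r\<le>L. \<alpha>_r / ((L - r)! (a + 1)_{L+r}))\<close>. Two different pairs
  \<open>(a, \<alpha>)\<close> produce this \<open>\<beta>\<close>: one with \<open>a = 3n + 1\<close>, which gives the left-hand
  series, and one with \<open>a = 4n + 2\<close> and \<open>\<alpha>\<close> supported on even indices, which gives the
  right-hand series.

  The interchange of summations is by dominated convergence. For \<open>a = 4n + 2\<close> all \<open>\<alpha>_r\<close>
  are nonnegative. For \<open>a = 3n + 1\<close> they alternate and the left-hand series may converge only
  conditionally, so the partial sums of \<open>\<beta>_L\<close> are bounded using the cancellation: the
  absolute values of the summands are unimodal in \<open>r\<close>, hence the partial sums do not exceed
  the largest of them, which is of relative size \<open>L^(n/2)\<close>.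
\<close>

section \<open>Gauss's summation theorem\<close>

definition power_bounded :: "(nat \<Rightarrow> complex) \<Rightarrow> real \<Rightarrow> bool" where
  "power_bounded f p \<longleftrightarrow> (\<exists>C. \<forall>k. norm (f k) \<le> C * real (k + 1) powr p)"

lemma power_bounded_mult:
  assumes "power_bounded f p" "power_bounded g q"
  shows "power_bounded (\<lambda>k. f k * g k) (p + q)"
proof -
  from assms obtain C D where C: "\<And>k. norm (f k) \<le> C * real (k + 1) powr p"
    and D: "\<And>k. norm (g k) \<le> D * real (k + 1) powr q"
    unfolding power_bounded_def by blast
  have "norm (f k * g k) \<le> C * D * real (k + 1) powr (p + q)" for k
    using mult_mono[OF C[of k] D[of k]] order_trans[OF norm_ge_zero C[of k]]
    by (simp add: norm_mult powr_add mult_ac)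
  then show ?thesis unfolding power_bounded_def by blast
qed

lemma power_bounded_summable:
  assumes "power_bounded f p" "p < -1"
  shows "summable (\<lambda>k. norm (f k))"
proof -
  from assms obtain C where C: "\<And>k. norm (f k) \<le> C * real (k + 1) powr p"
    unfolding power_bounded_def by blast
  have "summable (\<lambda>k. real (k + 1) powr p)"
    using summable_real_powr_iff[of p] summable_iff_shift[of "\<lambda>k. real k powr p" 1] assms by simp
  then have "summable (\<lambda>k. C * real (k + 1) powr p)" by (rule summable_mult)
  then show ?thesis
    by (rule summable_comparison_test'[where N = 0]) (use C in auto)
qed

text \<open>The limit defining \<open>rGamma\<close> shows that the modulus of the quotient, divided
  by k^Re(z - w), converges, and a convergent sequence is bounded. The limit exists because
  \<open>rGamma w\<close> is nonzero; it may be 0, so only an upper bound results.\<close>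

lemma power_bounded_pochhammer:
  fixes z w :: complex
  assumes "w \<notin> \<int>\<^sub>\<le>\<^sub>0"
  shows "power_bounded (\<lambda>k. pochhammer z k / pochhammer w k) (Re (z - w))"
proof -
  define p where "p = Re (z - w)"
  define X where "X k = norm (pochhammer z k) / (norm (pochhammer w k) * real (k + 1) powr p)" for k
  have nz: "pochhammer w k \<noteq> 0" for k
    using assms pochhammer_eq_0_imp_nonpos_Int by blast
  \<comment> \<open>\<open>rGamma_series\<close> at k carries k + 1 Pochhammer factors and a power
    of k, so it describes \<open>X (Suc k)\<close>; the factor (k / (k + 2))^p trades the base k for
    \<open>Suc k + 1\<close>.\<close>
  have ev: "norm (rGamma_series z k) / norm (rGamma_series w k) * (real k / real (k + 2)) powr p = X (Suc k)"
    if "k > 0" for k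
  proof -
    have e: "norm (exp (u * of_real (ln (real k)))) = real k powr Re u" for u :: complex
      using that by (simp add: powr_def mult.commute)
    have "norm (rGamma_series u k) = norm (pochhammer u (Suc k)) / (fact k * real k powr Re u)" for u :: complex
      using that e[of u] by (simp add: rGamma_series_def norm_divide norm_mult)
    moreover have "(real k / real (k + 2)) powr p = real k powr Re z / (real k powr Re w * real (k + 2) powr p)"
      using that by (simp add: powr_divide p_def powr_diff)
    moreover have "real k powr Re z > 0" "real k powr Re w > 0" using that by auto
    moreover have "real (Suc k + 1) = real (k + 2)" by simp
    ultimately show ?thesis
      using that nz[of "Suc k"]
      by (simp only: X_def) (simp add: field_simps)
  qed
  have "(\<lambda>k. norm (rGamma_series z k) / norm (rGamma_series w k) * (real k / real (k + 2)) powr p)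
          \<longlonglongrightarrow> norm (rGamma z) / norm (rGamma w) * 1 powr p"
  proof (intro tendsto_intros)
    show "norm (rGamma w) \<noteq> 0" using assms by (simp add: rGamma_eq_zero_iff)
    show "(\<lambda>k. real k / real (k + 2)) \<longlonglongrightarrow> 1"
      by real_asymp
  qed auto
  then have "(\<lambda>k. X (Suc k)) \<longlonglongrightarrow> norm (rGamma z) / norm (rGamma w) * 1 powr p"
    by (rule Lim_transform_eventually)
       (use ev in \<open>auto intro!: eventually_mono[OF eventually_gt_at_top[of 0]]\<close>)
  then have "convergent X"
    by (auto simp: convergent_def intro: LIMSEQ_imp_Suc)
  then obtain C where C: "C > 0" "\<And>k. norm (X k) \<le> C"
    using Bseq_def convergent_imp_Bseq by metis
  have "norm (pochhammer z k / pochhammer w k) \<le> C * real (k + 1) powr Re (z - w)" for k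
  proof -
    have "X k \<le> C" using C(2)[of k] by auto
    then show ?thesis
      by (simp add: X_def p_def norm_divide divide_simps mult_ac split: if_splits)
  qed
  then show ?thesis unfolding power_bounded_def by blast
qed

text \<open>All factors cancel except one at each end. With u = a/2 this turns the very-well-poised
  parameter pair a/2 + 1 over a/2 into (a + 2k) / a.\<close>

lemma pochhammer_plus_one_quotient:
  fixes u :: "'a :: {field_char_0}"
  assumes "\<And>k. u + of_nat k \<noteq> 0"
  shows "pochhammer (u + 1) k / pochhammer u k = (u + of_nat k) / u"
proof -
  have "u \<noteq> 0" using assms[of 0] by simp
  have "pochhammer u k \<noteq> 0" using assms by (auto simp: pochhammer_eq_0_iff eq_neg_iff_add_eq_0)
  then show ?thesis
    using pochhammer_rec[of u k] pochhammer_Suc[of u k] \<open>u \<noteq> 0\<close> by (simp add: frac_eq_eq mult_ac)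
qed

lemma pochhammer_eventually_0:
  assumes "c \<in> \<int>\<^sub>\<le>\<^sub>0"
  shows "eventually (\<lambda>k. pochhammer (c :: complex) k = 0) sequentially"
proof -
  from assms obtain N where "c = - of_nat N" by (elim nonpos_Ints_cases')
  then show ?thesis
    by (auto simp: pochhammer_of_nat_eq_0_iff intro: eventually_mono[OF eventually_gt_at_top[of N]])
qed

section \<open>Convergence of Gauss's series and its contiguity in the lower parameter\<close>

definition gauss_term :: "complex \<Rightarrow> complex \<Rightarrow> complex \<Rightarrow> nat \<Rightarrow> complex" where
  "gauss_term c d e k = pochhammer c k * pochhammer d k / (fact k * pochhammer e k)"

lemma power_bounded_gauss_term:
  assumes e: "e \<notin> \<int>\<^sub>\<le>\<^sub>0"
  shows "power_bounded (gauss_term c d e) (Re (c + d - e) - 1)"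
proof -
  have "power_bounded (\<lambda>k. (pochhammer c k / pochhammer e k) * (pochhammer d k / pochhammer 1 k))
          (Re (c - e) + Re (d - 1))"
    by (intro power_bounded_mult power_bounded_pochhammer e) auto
  moreover have "(\<lambda>k. (pochhammer c k / pochhammer e k) * (pochhammer d k / pochhammer 1 k)) = gauss_term c d e"
    by (simp add: gauss_term_def[abs_def] pochhammer_fact mult_ac)
  ultimately show ?thesis by (simp add: algebra_simps)
qed

text \<open>The first alternative makes 2F1(c, d; e; 1) converge, the other two make it terminate.
  The terminating cases carry no restriction on real parts.\<close>

definition gauss_admissible :: "complex \<Rightarrow> complex \<Rightarrow> complex \<Rightarrow> bool" where
  "gauss_admissible c d e \<longleftrightarrow> Re (e - c - d) > 0 \<or> c \<in> \<int>\<^sub>\<le>\<^sub>0 \<or> d \<in> \<int>\<^sub>\<le>\<^sub>0"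

lemma gauss_admissible_Suc: "gauss_admissible c d e \<Longrightarrow> gauss_admissible c d (e + 1)"
  by (auto simp: gauss_admissible_def)

text \<open>Unless it vanishes eventually, the summand is O(k^(Re (c + d - e) - 1)) with Re (c + d -
  e) negative. The second limit disposes of the boundary term when the contiguous relation is
  telescoped.\<close>

lemma gauss_term_tendsto:
  assumes e: "e \<notin> \<int>\<^sub>\<le>\<^sub>0" and adm: "gauss_admissible c d e"
  shows "summable (gauss_term c d e)" "(\<lambda>k. of_nat k * gauss_term c d e k) \<longlonglongrightarrow> 0"
proof -
  have *: "summable (gauss_term c d e) \<and> (\<lambda>k. of_nat k * gauss_term c d e k) \<longlonglongrightarrow> 0"
  proof (cases "c \<in> \<int>\<^sub>\<le>\<^sub>0 \<or> d \<in> \<int>\<^sub>\<le>\<^sub>0")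
    case True
    then have ev: "eventually (\<lambda>k. gauss_term c d e k = 0) sequentially"
      by (auto simp: gauss_term_def dest!: pochhammer_eventually_0 elim!: eventually_mono)
    have "summable (gauss_term c d e)"
      using summable_cong[OF ev] by simp
    moreover have "(\<lambda>k. of_nat k * gauss_term c d e k) \<longlonglongrightarrow> 0"
      by (rule tendsto_eventually) (use ev in \<open>auto elim!: eventually_mono\<close>)
    ultimately show ?thesis ..
  next
    case False
    with adm have re: "Re (c + d - e) < 0" by (auto simp: gauss_admissible_def)
    obtain C where C: "\<And>k. norm (gauss_term c d e k) \<le> C * real (k + 1) powr (Re (c + d - e) - 1)"
      using power_bounded_gauss_term[OF e] unfolding power_bounded_def by blast
    have 1: "summable (gauss_term c d e)"
      by (rule summable_norm_cancel, rule power_bounded_summable[OF power_bounded_gauss_term[OF e]])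
         (use re in auto)
    have "(\<lambda>k. C * real (k + 1) powr Re (c + d - e)) \<longlonglongrightarrow> C * 0"
    proof (intro tendsto_mult tendsto_const tendsto_neg_powr re)
      show "filterlim (\<lambda>k. real (k + 1)) at_top sequentially" by real_asymp
    qed
    then have lim: "(\<lambda>k. C * real (k + 1) powr Re (c + d - e)) \<longlonglongrightarrow> 0" by simp
    have "(\<lambda>k. of_nat k * gauss_term c d e k) \<longlonglongrightarrow> 0"
    proof (rule Lim_null_comparison[OF always_eventually lim], rule allI)
      fix k
      have "norm (of_nat k * gauss_term c d e k) \<le>
            real (k + 1) * (C * real (k + 1) powr (Re (c + d - e) - 1))"
        unfolding norm_mult by (intro mult_mono C) auto
      also have "\<dots> = C * real (k + 1) powr Re (c + d - e)"
        by (simp add: powr_diff)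
      finally show "norm (of_nat k * gauss_term c d e k) \<le> C * real (k + 1) powr Re (c + d - e)" .
    qed
    with 1 show ?thesis ..
  qed
  then show "summable (gauss_term c d e)" "(\<lambda>k. of_nat k * gauss_term c d e k) \<longlonglongrightarrow> 0" by auto
qed

lemma of_real_notin_nonpos_Ints: "x > 0 \<Longrightarrow> complex_of_real x \<notin> \<int>\<^sub>\<le>\<^sub>0"
  by (auto simp: complex_nonpos_Reals_iff dest: nonpos_Ints_subset_nonpos_Reals[THEN subsetD])

lemma nonpos_Ints_add_of_nat_D: "z + of_nat m \<in> \<int>\<^sub>\<le>\<^sub>0 \<Longrightarrow> z \<in> \<int>\<^sub>\<le>\<^sub>0"
  for z :: complex
proof (elim nonpos_Ints_cases')
  fix k assume "z + of_nat m = - of_nat k"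
  then have "z = - of_nat (m + k)" by (simp add: algebra_simps eq_neg_iff_add_eq_0)
  then show "z \<in> \<int>\<^sub>\<le>\<^sub>0" by (simp only: minus_of_nat_in_nonpos_Ints)
qed

text \<open>Gauss's contiguous relation between e and e + 1. Termwise, the difference of the two
  sides telescopes through \<open>g\<close>, which is e * k times the summand, starts at 0 and tends
  to 0.\<close>

lemma gauss_contiguous:
  assumes e: "e \<notin> \<int>\<^sub>\<le>\<^sub>0" and adm: "gauss_admissible c d e"
  shows "e * (e - c - d) * (\<Sum>k. gauss_term c d e k) = (e - c) * (e - d) * (\<Sum>k. gauss_term c d (e + 1) k)"
proof -
  have e1: "e + 1 \<notin> \<int>\<^sub>\<le>\<^sub>0" using e by (meson plus_one_in_nonpos_Ints_imp)
  define g where "g k = e * (of_nat k * gauss_term c d e k)" for k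
  have tele: "e * (e - c - d) * gauss_term c d e k - (e - c) * (e - d) * gauss_term c d (e + 1) k =
        g k - g (Suc k)" for k
  proof -
    have nz: "pochhammer e k \<noteq> 0" "e + of_nat k \<noteq> 0" "e \<noteq> 0"
      using e pochhammer_eq_0_imp_nonpos_Int plus_of_nat_eq_0_imp by auto
    have nz': "of_nat k + 1 \<noteq> (0 :: complex)" by (metis of_nat_Suc of_nat_eq_0_iff nat.distinct(1) add.commute)
    have p1: "pochhammer (e + 1) k = pochhammer e k * (e + of_nat k) / e"
      using pochhammer_rec[of e k] pochhammer_Suc[of e k] nz by (simp add: field_simps)
    have t1: "gauss_term c d (e + 1) k = gauss_term c d e k * e / (e + of_nat k)"
      using nz by (simp add: gauss_term_def p1)
    have t2: "of_nat (Suc k) * gauss_term c d e (Suc k) =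
              gauss_term c d e k * (c + of_nat k) * (d + of_nat k) / (e + of_nat k)"
      using nz nz' by (simp add: gauss_term_def pochhammer_Suc divide_simps del: of_nat_Suc) 
    show ?thesis
      using nz by (simp only: g_def t1 t2) (simp add: field_simps)
  qed
  have "g \<longlonglongrightarrow> e * 0"
    unfolding g_def by (intro tendsto_mult tendsto_const gauss_term_tendsto assms)
  then have "(\<lambda>k. g k - g (Suc k)) sums (g 0 - 0)"
    by (intro telescope_sums') simp
  then have "(\<lambda>k. e * (e - c - d) * gauss_term c d e k - (e - c) * (e - d) * gauss_term c d (e + 1) k) sums 0"
    by (simp add: tele) (simp add: g_def)
  moreover have "(\<lambda>k. e * (e - c - d) * gauss_term c d e k - (e - c) * (e - d) * gauss_term c d (e + 1) k) sums
     (e * (e - c - d) * (\<Sum>k. gauss_term c d e k) - (e - c) * (e - d) * (\<Sum>k. gauss_term c d (e + 1) k))"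
    by (intro sums_diff sums_mult summable_sums gauss_term_tendsto assms e1 gauss_admissible_Suc)
  ultimately show ?thesis using sums_unique2 by fastforce
qed

text \<open>The contiguous relation iterated m times. As m grows, the Pochhammer quotient becomes a
  Gamma quotient and the remaining sum tends to 1.\<close>

lemma gauss_shift:
  assumes e: "e \<notin> \<int>\<^sub>\<le>\<^sub>0" and e': "e - c - d \<notin> \<int>\<^sub>\<le>\<^sub>0" and adm: "gauss_admissible c d e"
  shows "(\<Sum>k. gauss_term c d e k) =
     pochhammer (e - c) m * pochhammer (e - d) m / (pochhammer e m * pochhammer (e - c - d) m) *
     (\<Sum>k. gauss_term c d (e + of_nat m) k)"
proof (induction m)
  case (Suc m)
  have 1: "e + of_nat m \<notin> \<int>\<^sub>\<le>\<^sub>0" using e nonpos_Ints_add_of_nat_D by blast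
  have adm': "gauss_admissible c d (e + of_nat m)"
    using adm by (auto simp: gauss_admissible_def)
  have nz: "e + of_nat m \<noteq> 0" "e - c - d + of_nat m \<noteq> 0" "e + of_nat m - c - d \<noteq> 0"
    using e e' plus_of_nat_eq_0_imp[of e m] plus_of_nat_eq_0_imp[of "e - c - d" m]
    by (auto simp: algebra_simps)
  have nz2: "pochhammer e m \<noteq> 0" "pochhammer (e - c - d) m \<noteq> 0"
    using e e' pochhammer_eq_0_imp_nonpos_Int by blast+
  define X Y where "X = (\<Sum>k. gauss_term c d (e + of_nat m) k)"
    and "Y = (\<Sum>k. gauss_term c d (e + of_nat (Suc m)) k)"
  have "(e + of_nat m) * (e - c - d + of_nat m) * X = (e - c + of_nat m) * (e - d + of_nat m) * Y"
    using gauss_contiguous[OF 1 adm'] by (simp add: X_def Y_def algebra_simps)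
  then have "X = (e - c + of_nat m) * (e - d + of_nat m) / ((e + of_nat m) * (e - c - d + of_nat m)) *
 Y"
    using nz by (simp add: nonzero_eq_divide_eq mult_ac)
  then show ?case
    using nz2 by (simp only: Suc.IH pochhammer_Suc flip: X_def Y_def) (simp add: mult_ac)
qed auto

section \<open>Gauss's series for a large lower parameter\<close>

lemma pochhammer_nonneg_of_nonneg: "x \<ge> 0 \<Longrightarrow> pochhammer x k \<ge> 0" for x :: real
  by (auto simp: pochhammer_prod intro!: prod_nonneg)

lemma norm_pochhammer_le_of_real: "norm (pochhammer (c :: complex) k) \<le> pochhammer (norm c) k"
proof (induction k)
  case (Suc k)
  have "norm (c + of_nat k) \<le> norm c + real k"
    by (metis norm_triangle_ineq norm_of_nat)
  then show ?case
    unfolding pochhammer_Suc norm_mult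
    by (intro mult_mono Suc) (auto intro: pochhammer_nonneg_of_nonneg)
qed auto

text \<open>Reverse triangle inequality, factor by factor: |e + m + j| >= m + j - |e| >= x +
  j.\<close>

lemma pochhammer_le_norm:
  assumes "x \<ge> 0" "x + norm e \<le> real m"
  shows "pochhammer x k \<le> norm (pochhammer (e + of_nat m :: complex) k)"
proof (induction k)
  case (Suc k)
  have "real m + real k - norm e \<le> norm (e + of_nat m + of_nat k)"
  proof -
    have "norm (of_nat (m + k) :: complex) \<le> norm (e + of_nat m + of_nat k) + norm e"
      using norm_triangle_ineq4[of "e + of_nat m + of_nat k" e] by (simp add: add_ac del: norm_of_nat)
    then show ?thesis unfolding norm_of_nat by linarith
  qed
  then have "x + real k \<le> norm (e + of_nat m + of_nat k)" using assms by linarith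
  then show ?case using Suc assms
    by (auto simp: pochhammer_Suc norm_mult intro!: mult_mono pochhammer_nonneg)
qed auto

text \<open>The summand at k = 0 is 1; the others are dominated by E / (m - |e|) times a fixed
  summable sequence, so their sum is O(1/m).\<close>

lemma gauss_sum_tendsto_1: "(\<lambda>m. \<Sum>k. gauss_term c d (e + of_nat m) k) \<longlonglongrightarrow> 1"
proof -
  \<comment> \<open>With this lower parameter the majorant \<open>M\<close> has growth exponent |c|
    + |d| - E - 1 = -2.\<close>
  define E where "E = norm c + norm d + 1"
  define M where "M k = norm (gauss_term (of_real (norm c)) (of_real (norm d)) (of_real E) k)" for k
  have E: "E > 0" unfolding E_def by (intro add_nonneg_pos) auto
  then have Enz: "complex_of_real E \<notin> \<int>\<^sub>\<le>\<^sub>0"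
    by (rule of_real_notin_nonpos_Ints)
  have sM: "summable M"
    unfolding M_def
    by (rule power_bounded_summable[OF power_bounded_gauss_term[OF Enz]]) (simp add: E_def)
  have M: "M k = pochhammer (norm c) k * pochhammer (norm d) k / (fact k * pochhammer E k)" for k
    using E unfolding M_def gauss_term_def pochhammer_of_real norm_divide norm_mult norm_of_real norm_fact
    by (subst (1 2 3) abs_of_nonneg) (auto intro: pochhammer_nonneg_of_nonneg)
  have bnd: "norm (gauss_term c d (e + of_nat m) (Suc k)) \<le> E / x * M (Suc k)"
    if x: "x \<ge> E" "x + norm e \<le> real m" for m x k
  proof -
    \<comment> \<open>The gain x / E comes from the first Pochhammer factor alone; the others are
      compared one by one. It needs at least one factor, hence the index
      \<open>Suc k\<close>.\<close>
    have "x / E * pochhammer E (Suc k) = x * pochhammer (E + 1) k"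
      using E by (simp add: pochhammer_rec)
    also have "\<dots> \<le> x * pochhammer (x + 1) k"
      using E x by (auto simp: pochhammer_prod intro!: mult_left_mono prod_mono)
    also have "\<dots> = pochhammer x (Suc k)" by (simp add: pochhammer_rec)
    also have "\<dots> \<le> norm (pochhammer (e + of_nat m) (Suc k))"
      by (rule pochhammer_le_norm) (use E x in auto)
    finally have 1: "x / E * pochhammer E (Suc k) \<le> norm (pochhammer (e + of_nat m) (Suc k))" .
    have pos: "x / E * pochhammer E (Suc k) > 0" using E x by (intro mult_pos_pos divide_pos_pos pochhammer_pos) auto
    have "norm (gauss_term c d (e + of_nat m) (Suc k)) =
       norm (pochhammer c (Suc k)) * norm (pochhammer d (Suc k)) / (fact (Suc k) * norm (pochhammer (e + of_nat m) (Suc k)))"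
      by (simp add: gauss_term_def norm_divide norm_mult del: fact_Suc of_nat_Suc)
    also have "\<dots> \<le> pochhammer (norm c) (Suc k) * pochhammer (norm d) (Suc k) / (fact (Suc k) * (x / E * pochhammer E (Suc k)))"
      by (intro frac_le mult_mono mult_nonneg_nonneg 1 norm_pochhammer_le_of_real pochhammer_nonneg_of_nonneg mult_pos_pos[OF fact_gt_zero pos])
         (use E x in auto)
    also have "\<dots> = E / x * M (Suc k)" using E x by (simp add: M field_simps del: fact_Suc of_nat_Suc)
    finally show ?thesis .
  qed
  have sM': "summable (\<lambda>k. M (Suc k))" using sM by (simp add: summable_Suc_iff)
  have main: "norm ((\<Sum>k. gauss_term c d (e + of_nat m) k) - 1) \<le> E / (real m - norm e) * (\<Sum>k. M (Suc k))"
    if m: "real m \<ge> E + norm e" for m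
  proof -
    have b: "norm (gauss_term c d (e + of_nat m) (Suc k)) \<le> E / (real m - norm e) * M (Suc k)" for k
      by (rule bnd) (use m in auto)
    have "summable (\<lambda>k. E / (real m - norm e) * M (Suc k))" by (intro summable_mult sM')
    then have s: "summable (\<lambda>k. norm (gauss_term c d (e + of_nat m) (Suc k)))"
      by (rule summable_comparison_test'[where N = 0]) (use b in auto)
    then have s1: "summable (\<lambda>k. gauss_term c d (e + of_nat m) k)"
      using summable_norm_cancel summable_Suc_iff by blast
    have "norm ((\<Sum>k. gauss_term c d (e + of_nat m) k) - 1) = norm (\<Sum>k. gauss_term c d (e + of_nat m) (Suc k))"
      using suminf_split_head[OF s1] by (simp add: gauss_term_def)
    also have "\<dots> \<le> (\<Sum>k. norm (gauss_term c d (e + of_nat m) (Suc k)))" by (rule summable_norm[OF s])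
    also have "\<dots> \<le> (\<Sum>k. E / (real m - norm e) * M (Suc k))"
      by (intro suminf_le b s summable_mult sM')
    also have "\<dots> = E / (real m - norm e) * (\<Sum>k. M (Suc k))" by (rule suminf_mult[OF sM'])
    finally show ?thesis .
  qed
  have "(\<lambda>m. E / (real m - norm e)) \<longlonglongrightarrow> 0"
    by real_asymp
  then have "(\<lambda>m. E / (real m - norm e) * (\<Sum>k. M (Suc k))) \<longlonglongrightarrow> 0"
    by (rule tendsto_mult_left_zero)
  then have "(\<lambda>m. (\<Sum>k. gauss_term c d (e + of_nat m) k) - 1) \<longlonglongrightarrow> 0"
    by (rule Lim_null_comparison[rotated])
       (use main in \<open>auto intro!: eventually_mono[OF eventually_ge_at_top[of "nat \<lceil>E + norm e\<rceil>"]] simp: nat_le_iff ceiling_le_iff\<close>)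
  then show ?thesis by (simp add: LIM_zero_iff)
qed

text \<open>The limit m to infinity in \<open>gauss_shift\<close>. Writing \<open>rGamma\<close> at
  e - c and e - d keeps the formula correct, with value 0, when Gamma has a pole there.\<close>

theorem gauss_sum:
  assumes e: "e \<notin> \<int>\<^sub>\<le>\<^sub>0" and e': "e - c - d \<notin> \<int>\<^sub>\<le>\<^sub>0" and adm: "gauss_admissible c d e"
  shows "gauss_term c d e sums (Gamma e * Gamma (e - c - d) * rGamma (e - c) * rGamma (e - d))"
proof -
  have "(\<lambda>m. rGamma_series (e - c) m * rGamma_series (e - d) m / (rGamma_series e m * rGamma_series (e - c - d) m) *
     (\<Sum>k. gauss_term c d (e + of_nat (Suc m)) k)) \<longlonglongrightarrow>
     rGamma (e - c) * rGamma (e - d) / (rGamma e * rGamma (e - c - d)) * 1"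
    by (intro tendsto_intros LIMSEQ_Suc[OF gauss_sum_tendsto_1])
       (use e e' in \<open>auto simp: rGamma_eq_zero_iff\<close>)
  moreover have "rGamma_series (e - c) m * rGamma_series (e - d) m / (rGamma_series e m * rGamma_series (e - c - d) m) *
     (\<Sum>k. gauss_term c d (e + of_nat (Suc m)) k) = (\<Sum>k. gauss_term c d e k)" for m
  proof -
    \<comment> \<open>The powers of m cancel because (e - c) + (e - d) = e + (e - c - d).\<close>
    have "exp ((e - c) * of_real (ln (real m))) * exp ((e - d) * of_real (ln (real m))) =
          exp (e * of_real (ln (real m))) * exp ((e - c - d) * of_real (ln (real m)))"
      by (simp add: exp_add[symmetric] algebra_simps)
    then have "rGamma_series (e - c) m * rGamma_series (e - d) m / (rGamma_series e m * rGamma_series (e - c - d) m) =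
     pochhammer (e - c) (Suc m) * pochhammer (e - d) (Suc m) / (pochhammer e (Suc m) * pochhammer (e - c - d) (Suc m))"
      by (simp add: rGamma_series_def mult_ac)
    then show ?thesis by (simp only: gauss_shift[OF assms, of "Suc m", symmetric])
  qed
  ultimately have "(\<Sum>k. gauss_term c d e k) = rGamma (e - c) * rGamma (e - d) / (rGamma e * rGamma (e - c - d))"
    by (simp add: LIMSEQ_const_iff)
  also have "\<dots> = Gamma e * Gamma (e - c - d) * rGamma (e - c) * rGamma (e - d)"
    by (simp add: Gamma_def field_simps)
  finally show ?thesis
    using gauss_term_tendsto(1)[OF e adm] by (metis summable_sums)
qed

section \<open>Bailey's transform\<close>

text \<open>The kernel joining alpha and beta in a Bailey pair relative to a, in the ordinary (q =
  1) case. Being 0 for r > L, it lets both indices range over all naturals.\<close>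

definition bailey_kernel :: "complex \<Rightarrow> nat \<Rightarrow> nat \<Rightarrow> complex" where
  "bailey_kernel a L r = (if r \<le> L then 1 / (fact (L - r) * pochhammer (a + 1) (L + r)) else 0)"

text \<open>Replacing L by L + r gives Gauss's series with parameters c + r, d + r and a + 1 + 2r;
  its excess a + 1 - c - d does not depend on r.\<close>

lemma bailey_kernel_sums:
  assumes a: "a + 1 \<notin> \<int>\<^sub>\<le>\<^sub>0" "a + 1 - c \<notin> \<int>\<^sub>\<le>\<^sub>0" "a + 1 - d \<notin> \<int>\<^sub>\<le>\<^sub>0" "a + 1 - c - d \<notin> \<int>\<^sub>\<le>\<^sub>0"
    and adm: "gauss_admissible c d (a + 1)"
  shows "(\<lambda>L. pochhammer c L * pochhammer d L * bailey_kernel a L r) sums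
    (Gamma (a + 1) * Gamma (a + 1 - c - d) / (Gamma (a + 1 - c) * Gamma (a + 1 - d)) *
     (pochhammer c r * pochhammer d r / (pochhammer (a + 1 - c) r * pochhammer (a + 1 - d) r)))"
proof -
  let ?t = "\<lambda>L. pochhammer c L * pochhammer d L * bailey_kernel a L r"
  have t: "?t (L + r) = pochhammer c r * pochhammer d r / pochhammer (a + 1) (2 * r) *
        gauss_term (c + of_nat r) (d + of_nat r) (a + 1 + of_nat (2 * r)) L" for L
  proof -
    have "L + r + r = 2 * r + L" by simp
    then have 1: "pochhammer (a + 1) (L + r + r) = pochhammer (a + 1) (2 * r) * pochhammer (a + 1 + of_nat (2 * r)) L"
      by (simp only: pochhammer_product')
    have 2: "pochhammer u (L + r) = pochhammer u r * pochhammer (u + of_nat r) L" for u :: complex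
      using pochhammer_product'[of u r L] by (simp only: add.commute)
    have 3: "bailey_kernel a (L + r) r = 1 / (fact L * pochhammer (a + 1) (L + r + r))"
      by (simp add: bailey_kernel_def)
    show ?thesis
      unfolding 3 1 2 gauss_term_def by (simp add: mult_ac)
  qed
  have "(\<lambda>L. ?t (L + r)) sums
    (Gamma (a + 1) * Gamma (a + 1 - c - d) / (Gamma (a + 1 - c) * Gamma (a + 1 - d)) *
     (pochhammer c r * pochhammer d r / (pochhammer (a + 1 - c) r * pochhammer (a + 1 - d) r)))"
  proof (cases "pochhammer c r * pochhammer d r = 0")
    case True
    then show ?thesis by (auto simp: t)
  next
    case False
    \<comment> \<open>A nonpositive integer u with (u)_r nonzero satisfies u + r <= 0, so a
      terminating series still terminates after the shift.\<close>
    have "u + of_nat r \<in> \<int>\<^sub>\<le>\<^sub>0" if "u \<in> \<int>\<^sub>\<le>\<^sub>0" "pochhammer u r \<noteq> 0" for u :: complex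
    proof -
      from that(1) obtain N where N: "u = - of_nat N" by (elim nonpos_Ints_cases')
      with that(2) have "r \<le> N" by (auto simp: pochhammer_of_nat_eq_0_iff)
      then have "u + of_nat r = - of_nat (N - r)" by (simp add: N)
      then show ?thesis by (simp only: minus_of_nat_in_nonpos_Ints)
    qed
    then have adm': "gauss_admissible (c + of_nat r) (d + of_nat r) (a + 1 + of_nat (2 * r))"
      using adm False by (auto simp: gauss_admissible_def)
    have e: "a + 1 + of_nat (2 * r) \<notin> \<int>\<^sub>\<le>\<^sub>0"
      using a nonpos_Ints_add_of_nat_D by blast
    have eq: "a + 1 + of_nat (2 * r) - (c + of_nat r) - (d + of_nat r) = a + 1 - c - d"
      "a + 1 + of_nat (2 * r) - (c + of_nat r) = a + 1 - c + of_nat r"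
      "a + 1 + of_nat (2 * r) - (d + of_nat r) = a + 1 - d + of_nat r"
      by (simp_all add: algebra_simps)
    have "(\<lambda>L. ?t (L + r)) sums (pochhammer c r * pochhammer d r / pochhammer (a + 1) (2 * r) *
      (Gamma (a + 1 + of_nat (2 * r)) * Gamma (a + 1 - c - d) *
       rGamma (a + 1 - c + of_nat r) * rGamma (a + 1 - d + of_nat r)))"
      unfolding t using gauss_sum[OF e _ adm'] a(4) unfolding eq by (intro sums_mult) auto
    moreover have Ga: "Gamma (a + 1 + of_nat (2 * r)) = pochhammer (a + 1) (2 * r) * Gamma (a + 1)"
      using pochhammer_Gamma[OF a(1), of "2 * r"] a(1) by (simp add: Gamma_eq_zero_iff)
    moreover have rG: "rGamma (u + of_nat r) = 1 / (Gamma u * pochhammer u r)" if "u \<notin> \<int>\<^sub>\<le>\<^sub>0" for u :: complex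
    proof -
      have "pochhammer u r \<noteq> 0" using that pochhammer_eq_0_imp_nonpos_Int by blast
      then show ?thesis unfolding Gamma_def pochhammer_rGamma[of u r] by (simp add: divide_simps)
    qed
    moreover have "pochhammer (a + 1) (2 * r) \<noteq> 0"
      using a(1) pochhammer_eq_0_imp_nonpos_Int by blast
    ultimately show ?thesis
      unfolding Ga rG[OF a(2)] rG[OF a(3)] by (simp add: mult_ac del: of_nat_mult)
  qed
  then show ?thesis
    by (subst (asm) sums_iff_shift) (simp add: bailey_kernel_def)
qed

text \<open>For finite R the sum over r <= R commutes with the sum over L, which
  \<open>bailey_kernel_sums\<close> evaluates. Tannery's theorem with majorant \<open>B\<close> then
  gives the limit in R. Since \<open>B\<close> bounds partial sums and not sums of absolute values,
  cancellation in alpha can be exploited.\<close>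

theorem bailey_transform:
  fixes \<alpha> \<beta> :: "nat \<Rightarrow> complex"
  assumes a: "a + 1 \<notin> \<int>\<^sub>\<le>\<^sub>0" "a + 1 - c \<notin> \<int>\<^sub>\<le>\<^sub>0" "a + 1 - d \<notin> \<int>\<^sub>\<le>\<^sub>0" "a + 1 - c - d \<notin> \<int>\<^sub>\<le>\<^sub>0"
    and adm: "gauss_admissible c d (a + 1)"
    and \<beta>: "\<And>L. \<beta> L = (\<Sum>r\<le>L. \<alpha> r * bailey_kernel a L r)"
    and B: "\<And>L R. norm (\<Sum>r\<le>R. \<alpha> r * bailey_kernel a L r) \<le> B L"
    and summable_B: "summable (\<lambda>L. norm (pochhammer c L * pochhammer d L) * B L)"
  shows "(\<lambda>r. \<alpha> r * (pochhammer c r * pochhammer d r / (pochhammer (a + 1 - c) r * pochhammer (a + 1 - d) r))) sums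
    (Gamma (a + 1 - c) * Gamma (a + 1 - d) / (Gamma (a + 1) * Gamma (a + 1 - c - d)) *
     (\<Sum>L. pochhammer c L * pochhammer d L * \<beta> L))"
proof -
  define H where "H = Gamma (a + 1) * Gamma (a + 1 - c - d) / (Gamma (a + 1 - c) * Gamma (a + 1 - d))"
  define u where "u r = pochhammer c r * pochhammer d r / (pochhammer (a + 1 - c) r * pochhammer (a + 1 - d) r)" for r
  define f where "f L R = pochhammer c L * pochhammer d L * (\<Sum>r\<le>R. \<alpha> r * bailey_kernel a L r)" for L R
  have H: "H \<noteq> 0" using a by (simp add: H_def Gamma_eq_zero_iff)
  have sums: "(\<lambda>L. f L R) sums (H * (\<Sum>r\<le>R. \<alpha> r * u r))" for R
  proof -
    have "(\<lambda>L. \<Sum>r\<le>R. \<alpha> r * (pochhammer c L * pochhammer d L * bailey_kernel a L r)) sums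
          (\<Sum>r\<le>R. \<alpha> r * (H * u r))"
      unfolding H_def u_def by (intro sums_sum sums_mult bailey_kernel_sums a adm)
    then show ?thesis
      by (simp add: f_def sum_distrib_left mult_ac)
  qed
  have "(\<lambda>R. f L R) \<longlonglongrightarrow> pochhammer c L * pochhammer d L * \<beta> L" for L
  proof (rule tendsto_eventually, rule eventually_mono[OF eventually_ge_at_top[of L]])
    fix R assume "R \<ge> L"
    then have "(\<Sum>r\<le>R. \<alpha> r * bailey_kernel a L r) = \<beta> L"
      unfolding \<beta> by (intro sum.mono_neutral_right) (auto simp: bailey_kernel_def)
    then show "f L R = pochhammer c L * pochhammer d L * \<beta> L" by (simp add: f_def)
  qed
  moreover have "norm (f L R) \<le> norm (pochhammer c L * pochhammer d L) * B L" for L R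
    unfolding f_def norm_mult by (intro mult_left_mono B) auto
  ultimately have "(\<lambda>R. \<Sum>L. f L R) \<longlonglongrightarrow> (\<Sum>L. pochhammer c L * pochhammer d L * \<beta> L)"
    using tannerys_theorem[OF _ always_eventually summable_B, of f "\<lambda>L. pochhammer c L * pochhammer d L * \<beta> L" sequentially]
    by auto
  then have "(\<lambda>R. H * (\<Sum>r\<le>R. \<alpha> r * u r)) \<longlonglongrightarrow> (\<Sum>L. pochhammer c L * pochhammer d L * \<beta> L)"
    by (simp add: sums_unique[OF sums, symmetric])
  then have "(\<lambda>R. inverse H * (H * (\<Sum>r\<le>R. \<alpha> r * u r))) \<longlonglongrightarrow>
     inverse H * (\<Sum>L. pochhammer c L * pochhammer d L * \<beta> L)"
    by (intro tendsto_mult tendsto_const)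
  then have "(\<lambda>r. \<alpha> r * u r) sums (inverse H * (\<Sum>L. pochhammer c L * pochhammer d L * \<beta> L))"
    using H by (simp add: sums_def_le mult.assoc[symmetric])
  moreover have "inverse H = Gamma (a + 1 - c) * Gamma (a + 1 - d) / (Gamma (a + 1) * Gamma (a + 1 - c - d))"
    by (simp add: H_def)
  ultimately show ?thesis by (simp only: u_def)
qed

text \<open>Contiguity in L and in r, cleared of denominators so that both relations persist where
  the kernel vanishes: at the edge of its support the linear factor is 0.\<close>

lemma bailey_kernel_rec:
  assumes a: "a + 1 \<notin> \<int>\<^sub>\<le>\<^sub>0"
  shows "bailey_kernel a L r = (of_nat L + 1 - of_nat r) * (a + 1 + of_nat L + of_nat r) * bailey_kernel a (Suc L) r"
    and "(a + 1 + of_nat L + of_nat r) * bailey_kernel a L (Suc r) = (of_nat L - of_nat r) * bailey_kernel a L r"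
proof -
  have nz: "pochhammer (a + 1) k \<noteq> 0" "a + 1 + of_nat k \<noteq> 0" for k
    using a pochhammer_eq_0_imp_nonpos_Int plus_of_nat_eq_0_imp by blast+
  note nz = nz nz(2)[of "L + r"]
  show "bailey_kernel a L r = (of_nat L + 1 - of_nat r) * (a + 1 + of_nat L + of_nat r) * bailey_kernel a (Suc L) r"
  proof (cases "r \<le> L")
    case True
    then have "Suc L - r = Suc (L - r)" by simp
    moreover have "of_nat L + 1 - of_nat r = (of_nat (Suc (L - r)) :: complex)"
      using True by simp
    ultimately show ?thesis using True nz
      by (simp add: bailey_kernel_def pochhammer_Suc add_ac del: of_nat_Suc)
  next
    case False
    then consider "r = Suc L" | "r > Suc L" by linarith
    then show ?thesis by cases (auto simp: bailey_kernel_def)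
  qed
  show "(a + 1 + of_nat L + of_nat r) * bailey_kernel a L (Suc r) = (of_nat L - of_nat r) * bailey_kernel a L r"
  proof (cases "r < L")
    case True
    define k where "k = L - Suc r"
    have "L - r = Suc k" "L - Suc r = k" using True by (auto simp: k_def)
    moreover have "of_nat L - of_nat r = (of_nat (Suc k) :: complex)"
      using True by (simp add: k_def)
    ultimately show ?thesis using True nz
      by (simp add: bailey_kernel_def pochhammer_Suc add_ac del: of_nat_Suc)
  next
    case False
    then consider "r = L" | "r > L" by linarith
    then show ?thesis by cases (auto simp: bailey_kernel_def)
  qed
qed

section \<open>Two terminating well-poised sums\<close>

lemma eq_quotient_mult: "q * x = p * y \<Longrightarrow> q \<noteq> 0 \<Longrightarrow> x = p / q * y"
  for q x p y :: "'a :: field"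
  by (simp add: field_simps)

text \<open>The frame for both certificates below: the two sums differ in length by one, which the
  vanishing of \<open>h\<close> at \<open>Suc L\<close> repairs.\<close>

lemma telescoped_sums_eq:
  fixes f g h :: "nat \<Rightarrow> complex"
  assumes "\<And>r. q * f r - p * h r = g (Suc r) - g r"
    and "g 0 = 0" "g (Suc (Suc L)) = 0" "h (Suc L) = 0"
  shows "q * (\<Sum>r\<le>Suc L. f r) = p * (\<Sum>r\<le>L. h r)"
proof -
  have "q * (\<Sum>r\<le>Suc L. f r) - p * (\<Sum>r\<le>Suc L. h r) = (\<Sum>r<Suc (Suc L). g (Suc r) - g r)"
    by (simp only: assms(1)[symmetric] sum_subtractf sum_distrib_left lessThan_Suc_atMost)
  also have "\<dots> = 0" by (subst sum_lessThan_telescope) (simp add: assms)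
  finally show ?thesis using assms(4) by simp
qed

text \<open>Up to a factor free of r, \<open>bailey_kernel a L r\<close> is (-1)^r (-L)_r / (a + 1 +
  L)_r. Hence this is the classical terminating very-well-poised 5F4 sum at 1 with upper parameters
  a, a/2 + 1, b, e, -L.\<close>

lemma well_poised_5F4_sum:
  fixes a b e :: complex
  assumes a: "a + 1 \<notin> \<int>\<^sub>\<le>\<^sub>0" "a \<noteq> 0" and be: "a + 1 - b \<notin> \<int>\<^sub>\<le>\<^sub>0" "a + 1 - e \<notin> \<int>\<^sub>\<le>\<^sub>0"
  shows "(\<Sum>r\<le>L. (-1) ^ r * (a + 2 * of_nat r) * (pochhammer a r * pochhammer b r * pochhammer e r /
             (a * fact r * pochhammer (a + 1 - b) r * pochhammer (a + 1 - e) r)) * bailey_kernel a L r) =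
         pochhammer (a + 1 - b - e) L / (fact L * pochhammer (a + 1 - b) L * pochhammer (a + 1 - e) L)"
proof (induction L)
  case 0
  show ?case using a by (simp add: bailey_kernel_def)
next
  case (Suc L)
  define w where "w r = (-1) ^ r * (pochhammer a r * pochhammer b r * pochhammer e r /
             (a * fact r * pochhammer (a + 1 - b) r * pochhammer (a + 1 - e) r))" for r
  define l where "l = (of_nat L :: complex)"
  define K where "K = bailey_kernel a (Suc L)"
  define s where "s = a + 1 + l"
  \<comment> \<open>telescoping certificate for the first-order recurrence in \<open>L\<close> satisfied by both sides\<close>
  define g where "g r = - of_nat r * (a - b + of_nat r) * (a - e + of_nat r) * (s + of_nat r) * w r * K r" for r
  define q where "q = (l + 1) * (s - b) * (s - e)"
  define p where "p = s - b - e"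
  have nz: "a + 1 - b + of_nat k \<noteq> 0" "a + 1 - e + of_nat k \<noteq> 0" "of_nat k + 1 \<noteq> (0 :: complex)" for k
    using be plus_of_nat_eq_0_imp by (blast, blast) (metis of_nat_Suc of_nat_eq_0_iff nat.distinct(1) add.commute)
  have w: "(of_nat r + 1) * (a + 1 - b + of_nat r) * (a + 1 - e + of_nat r) * w (Suc r) =
           - ((a + of_nat r) * (b + of_nat r) * (e + of_nat r) * w r)" for r
    using nz[of r] by (simp add: w_def pochhammer_Suc add.commute[of 1]) (simp add: mult_ac)
  have K1: "bailey_kernel a L r = (l + 1 - of_nat r) * (s + of_nat r) * K r" for r
    using bailey_kernel_rec(1)[OF a(1), of L r] by (simp add: K_def l_def s_def)
  have K2: "(s + 1 + of_nat r) * K (Suc r) = (l + 1 - of_nat r) * K r" for r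
    using bailey_kernel_rec(2)[OF a(1), of "Suc L" r] by (simp add: K_def l_def s_def add_ac)
  have tele: "q * (\<Sum>r\<le>Suc L. (a + 2 * of_nat r) * w r * K r) = p * (\<Sum>r\<le>L. (a + 2 * of_nat r) * w r * bailey_kernel a L r)"
  proof (rule telescoped_sums_eq[where g = g])
    fix r
    define x where "x = (of_nat r :: complex)"
    have "g (Suc r) = - (((of_nat r + 1) * (a + 1 - b + of_nat r) * (a + 1 - e + of_nat r) * w (Suc r)) *
                         ((s + 1 + of_nat r) * K (Suc r)))"
      by (simp add: g_def algebra_simps)
    also have "\<dots> = (a + x) * (b + x) * (e + x) * (l + 1 - x) * (w r * K r)"
      unfolding w K2 x_def by (simp add: mult_ac)
    finally have g1: "g (Suc r) = (a + x) * (b + x) * (e + x) * (l + 1 - x) * (w r * K r)" .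
    \<comment> \<open>The polynomial identity behind the certificate; what follows only extracts the
      common factor \<open>w r * K r\<close>.\<close>
    have "(a + 2 * x) * (q - p * (l + 1 - x) * (s + x)) =
        (a + x) * (b + x) * (e + x) * (l + 1 - x) + x * (a - b + x) * (a - e + x) * (s + x)"
      unfolding q_def p_def s_def by algebra
    moreover have "q * ((a + 2 * of_nat r) * w r * K r) - p * ((a + 2 * of_nat r) * w r * bailey_kernel a L r) =
        (a + 2 * x) * (q - p * (l + 1 - x) * (s + x)) * (w r * K r)"
      unfolding K1 x_def[symmetric] by algebra
    moreover have "g (Suc r) - g r = ((a + x) * (b + x) * (e + x) * (l + 1 - x) + x * (a - b + x) * (a - e + x) * (s + x)) * (w r * K r)"
      unfolding g1 unfolding g_def x_def[symmetric] by algebra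
    ultimately show "q * ((a + 2 * of_nat r) * w r * K r) - p * ((a + 2 * of_nat r) * w r * bailey_kernel a L r) = g (Suc r) - g r"
      by simp
  qed (simp_all add: g_def K_def bailey_kernel_def)
  have IH: "(\<Sum>r\<le>L. (a + 2 * of_nat r) * w r * bailey_kernel a L r) =
       pochhammer (a + 1 - b - e) L / (fact L * pochhammer (a + 1 - b) L * pochhammer (a + 1 - e) L)"
    unfolding Suc.IH[symmetric] by (rule sum.cong) (simp_all add: w_def)
  have eq: "(\<Sum>r\<le>Suc L. (-1) ^ r * (a + 2 * of_nat r) * (pochhammer a r * pochhammer b r * pochhammer e r /
             (a * fact r * pochhammer (a + 1 - b) r * pochhammer (a + 1 - e) r)) * bailey_kernel a (Suc L) r) =
        (\<Sum>r\<le>Suc L. (a + 2 * of_nat r) * w r * K r)"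
    by (rule sum.cong) (simp_all add: w_def K_def)
  have q: "q = (of_nat L + 1) * (a + 1 - b + of_nat L) * (a + 1 - e + of_nat L)"
    and p: "p = a + 1 - b - e + of_nat L"
    by (simp_all add: q_def p_def s_def l_def add_ac add_diff_eq diff_add_eq)
  have q0: "q \<noteq> 0" unfolding q using nz by simp
  have "(\<Sum>r\<le>Suc L. (-1) ^ r * (a + 2 * of_nat r) * (pochhammer a r * pochhammer b r * pochhammer e r /
             (a * fact r * pochhammer (a + 1 - b) r * pochhammer (a + 1 - e) r)) * bailey_kernel a (Suc L) r) =
       (p / q) * (pochhammer (a + 1 - b - e) L / (fact L * pochhammer (a + 1 - b) L * pochhammer (a + 1 - e) L))"
    unfolding eq IH[symmetric] by (rule eq_quotient_mult[OF tele q0])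
  also have "\<dots> = pochhammer (a + 1 - b - e) (Suc L) /
      (fact (Suc L) * pochhammer (a + 1 - b) (Suc L) * pochhammer (a + 1 - e) (Suc L))"
    unfolding p q by (simp add: pochhammer_Suc add.commute[of 1] mult_ac)
  finally show ?case .
qed

text \<open>Splitting the factors of length 2k by duplication gives a terminating very-well-poised
  5F4 at 1 with a = A and upper parameters -L/2, (1 - L)/2 and (A + 1)/2, the last cancelling
  against its own lower partner. Terms with 2k > L are 0.\<close>

lemma quadratic_5F4_sum:
  fixes A :: complex
  assumes A: "2 * A \<notin> \<int>\<^sub>\<le>\<^sub>0"
  shows "(\<Sum>k\<le>L. (A + 2 * of_nat k) * (pochhammer A k / (A * fact k)) * bailey_kernel (2 * A) L (2 * k)) =
         pochhammer (A / 2) L / (fact L * pochhammer A L * pochhammer (A + 1 / 2) L)"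
proof (induction L)
  case 0
  have "A \<noteq> 0" using A by auto
  then show ?case by (simp add: bailey_kernel_def)
next
  case (Suc L)
  define w where "w k = pochhammer A k / (A * fact k)" for k
  define l where "l = (of_nat L :: complex)"
  define K where "K r = bailey_kernel (2 * A) (Suc L) r" for r
  define \<kappa> where "\<kappa> x = - (2 * x + A - 1)" for x
  \<comment> \<open>again a telescoping certificate for the recurrence in \<open>L\<close>\<close>
  define g where "g k = \<kappa> (of_nat k) * of_nat k * (2 * A + l + 2 * of_nat k) * (2 * A + 1 + l + 2 * of_nat k) * w k * K (2 * k)" for k
  define q where "q = (l + 1) * (A + l) * (2 * A + 2 * l + 1)"
  define p where "p = A + 2 * l"
  have a1: "2 * A + 1 \<notin> \<int>\<^sub>\<le>\<^sub>0" using A by (meson plus_one_in_nonpos_Ints_imp)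
  have nz0: "2 * A + of_nat k \<noteq> 0" "of_nat k + 1 \<noteq> (0 :: complex)" for k
    using A plus_of_nat_eq_0_imp by (blast) (metis of_nat_Suc of_nat_eq_0_iff nat.distinct(1) add.commute)
  have nz: "2 * A + of_nat L \<noteq> 0" "A + of_nat L \<noteq> 0" "2 * A + 2 * of_nat L + 1 \<noteq> 0" "A \<noteq> 0"
  proof -
    have "2 * A + of_nat (2 * L) = 2 * (A + of_nat L)" by simp
    then show "A + of_nat L \<noteq> 0" using nz0(1)[of "2 * L"] by (metis mult_zero_right)
  qed (use nz0(1)[of L] nz0(1)[of "2 * L + 1"] nz0(1)[of 0] in \<open>auto simp: add_ac\<close>)
  have w: "(of_nat k + 1) * w (Suc k) = (A + of_nat k) * w k" for k
    using nz0(2)[of k] by (simp add: w_def pochhammer_Suc add.commute[of 1])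
  have K1: "bailey_kernel (2 * A) L (2 * k) = (l + 1 - 2 * of_nat k) * (2 * A + 1 + l + 2 * of_nat k) * K (2 * k)" for k
    using bailey_kernel_rec(1)[OF a1, of L "2 * k"] by (simp add: K_def l_def)
  \<comment> \<open>Only even indices occur, so the recurrence in the second index is applied
    twice.\<close>
  have K2: "(2 * A + 2 + l + 2 * of_nat k) * (2 * A + 3 + l + 2 * of_nat k) * K (2 * Suc k) =
            (l + 1 - 2 * of_nat k) * (l - 2 * of_nat k) * K (2 * k)" for k
  proof -
    have 1: "(2 * A + 2 + l + 2 * of_nat k) * K (Suc (2 * k)) = (l + 1 - 2 * of_nat k) * K (2 * k)"
      using bailey_kernel_rec(2)[OF a1, of "Suc L" "2 * k"] by (simp add: K_def l_def add_ac)
    have 2: "(2 * A + 3 + l + 2 * of_nat k) * K (Suc (Suc (2 * k))) = (l - 2 * of_nat k) * K (Suc (2 * k))"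
      using bailey_kernel_rec(2)[OF a1, of "Suc L" "Suc (2 * k)"] by (simp add: K_def l_def add_ac)
    have "(2 * A + 2 + l + 2 * of_nat k) * ((2 * A + 3 + l + 2 * of_nat k) * K (Suc (Suc (2 * k)))) =
          (l - 2 * of_nat k) * ((2 * A + 2 + l + 2 * of_nat k) * K (Suc (2 * k)))"
      unfolding 2 by (simp add: mult_ac)
    then show ?thesis unfolding 1 by (simp add: mult_ac)
  qed
  have tele: "q * (\<Sum>k\<le>Suc L. (A + 2 * of_nat k) * w k * K (2 * k)) =
        p * (\<Sum>k\<le>L. (A + 2 * of_nat k) * w k * bailey_kernel (2 * A) L (2 * k))"
  proof (rule telescoped_sums_eq[where g = g])
    fix k
    define x where "x = (of_nat k :: complex)"
    have "g (Suc k) = \<kappa> (x + 1) * ((of_nat k + 1) * w (Suc k)) *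
        ((2 * A + 2 + l + 2 * of_nat k) * (2 * A + 3 + l + 2 * of_nat k) * K (2 * Suc k))"
      by (simp add: g_def x_def algebra_simps)
    also have "\<dots> = \<kappa> (x + 1) * (A + x) * (l + 1 - 2 * x) * (l - 2 * x) * (w k * K (2 * k))"
      unfolding w K2 x_def by (simp add: mult_ac)
    finally have g1: "g (Suc k) = \<kappa> (x + 1) * (A + x) * (l + 1 - 2 * x) * (l - 2 * x) * (w k * K (2 * k))" .
    have "(A + 2 * x) * (q - p * (l + 1 - 2 * x) * (2 * A + 1 + l + 2 * x)) =
       \<kappa> (x + 1) * (A + x) * (l + 1 - 2 * x) * (l - 2 * x) - \<kappa> x * x * (2 * A + l + 2 * x) * (2 * A + 1 + l + 2 * x)"
      unfolding q_def p_def \<kappa>_def by algebra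
    moreover have "q * ((A + 2 * of_nat k) * w k * K (2 * k)) - p * ((A + 2 * of_nat k) * w k * bailey_kernel (2 * A) L (2 * k)) =
       (A + 2 * x) * (q - p * (l + 1 - 2 * x) * (2 * A + 1 + l + 2 * x)) * (w k * K (2 * k))"
      unfolding K1 x_def[symmetric] by algebra
    moreover have "g (Suc k) - g k =
       (\<kappa> (x + 1) * (A + x) * (l + 1 - 2 * x) * (l - 2 * x) - \<kappa> x * x * (2 * A + l + 2 * x) * (2 * A + 1 + l + 2 * x)) * (w k * K (2 * k))"
      unfolding g1 unfolding g_def x_def[symmetric] by algebra
    ultimately show "q * ((A + 2 * of_nat k) * w k * K (2 * k)) - p * ((A + 2 * of_nat k) * w k * bailey_kernel (2 * A) L (2 * k)) = g (Suc k) - g k"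
      by simp
  qed (simp_all add: g_def K_def bailey_kernel_def)
  have IH: "(\<Sum>k\<le>L. (A + 2 * of_nat k) * w k * bailey_kernel (2 * A) L (2 * k)) =
       pochhammer (A / 2) L / (fact L * pochhammer A L * pochhammer (A + 1 / 2) L)"
    unfolding Suc.IH[symmetric] by (rule sum.cong) (simp_all add: w_def)
  have eq: "(\<Sum>k\<le>Suc L. (A + 2 * of_nat k) * (pochhammer A k / (A * fact k)) * bailey_kernel (2 * A) (Suc L) (2 * k)) =
        (\<Sum>k\<le>Suc L. (A + 2 * of_nat k) * w k * K (2 * k))"
    by (rule sum.cong) (simp_all add: w_def K_def)
  have q0: "q \<noteq> 0" using nz nz0(2)[of L] by (simp add: q_def l_def)
  have "(\<Sum>k\<le>Suc L. (A + 2 * of_nat k) * (pochhammer A k / (A * fact k)) * bailey_kernel (2 * A) (Suc L) (2 * k)) =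
     (p / q) * (pochhammer (A / 2) L / (fact L * pochhammer A L * pochhammer (A + 1 / 2) L))"
    unfolding eq IH[symmetric] by (rule eq_quotient_mult[OF tele q0])
  also have "p / q = (A / 2 + of_nat L) / ((of_nat L + 1) * (A + of_nat L) * (A + 1 / 2 + of_nat L))"
  proof -
    have "p / q = (2 * (A / 2 + of_nat L)) / (2 * ((of_nat L + 1) * (A + of_nat L) * (A + 1 / 2 + of_nat L)))"
      using nz(1) by (simp add: p_def q_def l_def algebra_simps)
    then show ?thesis by (subst (asm) mult_divide_mult_cancel_left) auto
  qed
  also have "(A / 2 + of_nat L) / ((of_nat L + 1) * (A + of_nat L) * (A + 1 / 2 + of_nat L)) *
      (pochhammer (A / 2) L / (fact L * pochhammer A L * pochhammer (A + 1 / 2) L)) =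
      pochhammer (A / 2) (Suc L) / (fact (Suc L) * pochhammer A (Suc L) * pochhammer (A + 1 / 2) (Suc L))"
    by (simp add: pochhammer_Suc add.commute[of 1] mult_ac)
  finally show ?case .
qed

section \<open>Bounds for alternating partial sums\<close>

text \<open>
  With \<open>s R = (-1)^R * (\<Sum>r\<le>R. (-1)^r * t r)\<close>, the invariant \<open>t R - M \<le> s R \<le> M\<close> is
  strengthened to \<open>0 \<le> s R \<le> t R\<close> on the increasing part.
\<close>

lemma abs_alternating_sum_unimodal_le:
  fixes t :: "nat \<Rightarrow> real"
  assumes nonneg: "\<And>r. 0 \<le> t r" and le: "\<And>r. t r \<le> M"
    and unimodal: "\<And>r s. t (Suc r) < t r \<Longrightarrow> r \<le> s \<Longrightarrow> t (Suc s) \<le> t s"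
  shows "\<bar>\<Sum>r\<le>R. (-1) ^ r * t r\<bar> \<le> M"
proof -
  define s where "s R = (-1) ^ R * (\<Sum>r\<le>R. (-1) ^ r * t r)" for R
  have s_Suc: "s (Suc R) = t (Suc R) - s R" for R
    by (simp add: s_def algebra_simps flip: power_mult_distrib)
  have "t R - M \<le> s R \<and> s R \<le> M \<and> ((\<forall>r<R. t r \<le> t (Suc r)) \<longrightarrow> 0 \<le> s R \<and> s R \<le> t R)" for R
  proof (induction R)
    case 0
    show ?case using nonneg[of 0] le[of 0] by (simp add: s_def)
  next
    case (Suc R)
    show ?case
    proof (cases "\<forall>r<R. t r \<le> t (Suc r)")
      case True
      then show ?thesis
        using Suc nonneg[of R] le[of R] le[of "Suc R"] nonneg[of "Suc R"] unfolding s_Suc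
        by (auto simp: less_Suc_eq)
    next
      case False
      then obtain r where "r < R" "t (Suc r) < t r" by force
      then have "t (Suc R) \<le> t R" using unimodal[of r R] by simp
      then show ?thesis using Suc False unfolding s_Suc by (auto simp: less_Suc_eq)
    qed
  qed
  from this[of R] have "\<bar>s R\<bar> \<le> M" using nonneg[of R] by linarith
  then show ?thesis by (simp add: s_def abs_mult)
qed

text \<open>After squaring, with y = r^2 / M, this is y^n <= n! exp y, a single term of the
  exponential series.\<close>

lemma power_exp_minus_le:
  assumes "M > 0"
  shows "real r ^ n * exp (- (real r)\<^sup>2 / M) \<le> sqrt (fact n) * sqrt M ^ n"
proof -
  define y where "y = (real r)\<^sup>2 / M"
  have y: "y \<ge> 0" using assms by (simp add: y_def)
  have "(real r ^ n * exp (- y))\<^sup>2 = M ^ n * (y ^ n * exp (- 2 * y))"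
  proof -
    have "(real r)\<^sup>2 = M * y" using assms by (simp add: y_def)
    then have "(real r ^ n)\<^sup>2 = M ^ n * y ^ n"
      by (metis power_mult_distrib power_mult mult.commute)
    then show ?thesis
      by (simp add: power_mult_distrib mult_ac flip: exp_double)
  qed
  also have "y ^ n * exp (- 2 * y) \<le> fact n"
  proof -
    have "y ^ n / fact n \<le> exp y"
    proof -
      have "(\<Sum>k\<in>{n}. inverse (fact k) * y ^ k) \<le> (\<Sum>k. inverse (fact k) * y ^ k)"
        by (intro sum_le_suminf summable_exp) (use y in auto)
      then show ?thesis by (simp add: exp_def scaleR_conv_of_real field_simps)
    qed
    also have "\<dots> \<le> exp (2 * y)" using y by simp
    finally show ?thesis by (simp add: exp_minus field_simps)
  qed
  finally have "(real r ^ n * exp (- y))\<^sup>2 \<le> M ^ n * fact n" using assms by simp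
  then have "real r ^ n * exp (- y) \<le> sqrt (M ^ n * fact n)" by (rule real_le_rsqrt)
  then show ?thesis by (simp add: y_def real_sqrt_mult real_sqrt_power mult_ac)
qed

section \<open>Size and unimodality of the summands for a = 3n + 1\<close>

context
  fixes n :: nat
begin

text \<open>The weight of \<open>well_poised_5F4_sum\<close> for a = 3n + 1, b = n + 1/2, e = n + 1
  without its sign, as a real number so that order arguments apply.\<close>

definition alt_coef :: "nat \<Rightarrow> real" where
  "alt_coef r = (3 * real n + 1 + 2 * real r) *
     (pochhammer (3 * real n + 1) r * pochhammer (real n + 1 / 2) r * pochhammer (real n + 1) r /
      ((3 * real n + 1) * fact r * pochhammer (2 * real n + 3 / 2) r * pochhammer (2 * real n + 1) r))"

definition alt_kernel :: "nat \<Rightarrow> nat \<Rightarrow> real" where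
  "alt_kernel L r = (if r \<le> L then 1 / (fact (L - r) * pochhammer (3 * real n + 2) (L + r)) else 0)"

definition alt_coef_ratio :: "nat \<Rightarrow> real" where
  "alt_coef_ratio r =
     ((real r + 3 * real n + 1) * (2 * real r + 3 * real n + 3) * (2 * real r + 2 * real n + 1) * (real r + real n + 1)) /
     ((real r + 1) * (2 * real r + 3 * real n + 1) * (real r + 2 * real n + 1) * (2 * real r + 4 * real n + 3))"

lemma alt_coef_pos: "alt_coef r > 0"
  unfolding alt_coef_def by (intro mult_pos_pos divide_pos_pos pochhammer_pos) auto

lemma alt_coef_Suc: "alt_coef (Suc r) = alt_coef_ratio r * alt_coef r"
proof -
  define x y where "x = real r" and "y = real n"
  have xy: "x \<ge> 0" "y \<ge> 0" by (auto simp: x_def y_def)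
  have nz: "x + 1 > 0" "2 * x + 3 * y + 1 > 0" "x + 2 * y + 1 > 0" "2 * x + 4 * y + 3 > 0"
    "2 * y + 3 / 2 + x > 0" "2 * y + 1 + x > 0" "3 * y + 1 > 0" using xy by auto
  define P where "P = pochhammer (3 * y + 1) r * pochhammer (y + 1 / 2) r * pochhammer (y + 1) r /
      ((3 * y + 1) * fact r * pochhammer (2 * y + 3 / 2) r * pochhammer (2 * y + 1) r)"
  have "alt_coef (Suc r) = (3 * y + 1 + 2 * (x + 1)) * ((3 * y + 1 + x) * (y + 1 / 2 + x) * (y + 1 + x) /
      ((x + 1) * (2 * y + 3 / 2 + x) * (2 * y + 1 + x))) * P"
    by (simp add: alt_coef_def P_def x_def y_def pochhammer_Suc mult_ac add.commute[of 1])
  moreover have "alt_coef r = (3 * y + 1 + 2 * x) * P" by (simp add: alt_coef_def P_def x_def y_def)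
  moreover have "(3 * y + 1 + 2 * (x + 1)) * ((3 * y + 1 + x) * (y + 1 / 2 + x) * (y + 1 + x) /
      ((x + 1) * (2 * y + 3 / 2 + x) * (2 * y + 1 + x))) = alt_coef_ratio r * (3 * y + 1 + 2 * x)"
  proof -
    have eq: "2 * y + 3 / 2 + x = (2 * x + 4 * y + 3) / 2" "y + 1 / 2 + x = (2 * x + 2 * y + 1) / 2"
        "3 * y + 1 + 2 * (x + 1) = 2 * x + 3 * y + 3" "3 * y + 1 + 2 * x = 2 * x + 3 * y + 1"
        "2 * y + 1 + x = x + 2 * y + 1" "3 * y + 1 + x = x + 3 * y + 1" "y + 1 + x = x + y + 1"
      by simp_all
    show ?thesis unfolding alt_coef_ratio_def x_def[symmetric] y_def[symmetric] eq
      using nz by (simp add: mult_ac)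
  qed
  ultimately show ?thesis by (metis mult.assoc)
qed

lemma alt_coef_ratio_pos: "alt_coef_ratio r > 0"
  unfolding alt_coef_ratio_def by (intro divide_pos_pos mult_pos_pos) auto

text \<open>Cross-multiplying the ratios at x and x + 1 leaves a polynomial in x and y all of whose
  coefficients are nonnegative.\<close>

lemma alt_coef_ratio_antimono: "r \<le> s \<Longrightarrow> alt_coef_ratio s \<le> alt_coef_ratio r"
proof (rule decseq_SucI[THEN decseqD])
  fix r
  define x y where "x = real r" and "y = real n"
  have xy: "x \<ge> 0" "y \<ge> 0" by (auto simp: x_def y_def)
  let ?N = "\<lambda>x. (x + 3 * y + 1) * (2 * x + 3 * y + 3) * (2 * x + 2 * y + 1) * (x + y + 1)"
  let ?D = "\<lambda>x. (x + 1) * (2 * x + 3 * y + 1) * (x + 2 * y + 1) * (2 * x + 4 * y + 3)"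
  have "?N x * ?D (x + 1) - ?N (x + 1) * ?D x = 
      36 * y + 389 * y ^ 2 + 1646 * y ^ 3 + 3461 * y ^ 4 +
      3792 * y ^ 5 + 2052 * y ^ 6 + 432 * y ^ 7 + 318 * (x * y) +
      2118 * (x * y ^ 2) + 5910 * (x * y ^ 3) + 8262 * (x * y ^ 4) + 5592 * (x * y ^ 5) +
      1440 * (x * y ^ 6) + 790 * (x ^ 2 * y) + 3732 * (x ^ 2 * y ^ 2) + 7058 * (x ^ 2 * y ^ 3) +
      6100 * (x ^ 2 * y ^ 4) + 1956 * (x ^ 2 * y ^ 5) + 888 * (x ^ 3 * y) + 2928 * (x ^ 3 * y ^ 2) +
      3456 * (x ^ 3 * y ^ 3) + 1416 * (x ^ 3 * y ^ 4) + 508 * (x ^ 4 * y) + 1060 * (x ^ 4 * y ^ 2) +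
      596 * (x ^ 4 * y ^ 3) + 144 * (x ^ 5 * y) + 144 * (x ^ 5 * y ^ 2) + 16 * (x ^ 6 * y)"
    by algebra
  also have "\<dots> \<ge> 0" using xy by (intro add_nonneg_nonneg mult_nonneg_nonneg) auto
  finally have "?N (x + 1) * ?D x \<le> ?N x * ?D (x + 1)" by simp
  moreover have "?D x > 0" "?D (x + 1) > 0" using xy by (intro mult_pos_pos; simp)+
  ultimately have "?N (x + 1) / ?D (x + 1) \<le> ?N x / ?D x"
    by (simp add: divide_le_eq pos_le_divide_eq mult_ac)
  moreover have "alt_coef_ratio r = ?N x / ?D x" "alt_coef_ratio (Suc r) = ?N (x + 1) / ?D (x + 1)"
    unfolding alt_coef_ratio_def x_def y_def by (simp_all add: add_ac)
  ultimately show "alt_coef_ratio (Suc r) \<le> alt_coef_ratio r" by simp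
qed

lemma alt_kernel_nonneg: "alt_kernel L r \<ge> 0"
  by (auto simp: alt_kernel_def intro!: divide_nonneg_nonneg mult_nonneg_nonneg pochhammer_nonneg_of_nonneg)

lemma alt_kernel_Suc:
  assumes "r \<le> L"
  shows "alt_kernel L (Suc r) = (real L - real r) / (3 * real n + 2 + real L + real r) * alt_kernel L r"
proof (cases "r = L")
  case False
  define k where "k = L - Suc r"
  have k: "L - r = Suc k" "L - Suc r = k" "real L - real r = real (Suc k)"
    using assms False by (auto simp: k_def)
  have "pochhammer (3 * real n + 2) (L + r) > 0" by (intro pochhammer_pos) auto
  then show ?thesis using assms False unfolding k
    by (simp add: alt_kernel_def k pochhammer_Suc add_ac del: of_nat_Suc)
qed (simp add: alt_kernel_def)

text \<open>Gaussian decay: with M the denominator of the exponent, the step from r to r + 1 costs a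
  factor of at most 1 - (2r + 1)/M <= exp (-(2r + 1)/M), and the first r odd numbers add up to
  r^2.\<close>

lemma alt_kernel_le: "alt_kernel L r \<le> alt_kernel L 0 * exp (- (real r)\<^sup>2 / (2 * real L + 3 * real n + 2))"
proof (induction r)
  case (Suc r)
  define M where "M = 2 * real L + 3 * real n + 2"
  show ?case
  proof (cases "r < L")
    case True
    define z where "z = (2 * real r + 1) / M"
    have quot: "(real L - real r) / (3 * real n + 2 + real L + real r) = 1 - (3 * real n + 2 + 2 * real r) / (3 * real n + 2 + real L + real r)"
    proof -
      have "3 * real n + 2 + real L + real r > 0" by (intro add_nonneg_pos add_pos_nonneg) auto
      then show ?thesis by (simp add: field_simps)
    qed
    have "(3 * real n + 2 + 2 * real r) / (3 * real n + 2 + real L + real r) \<ge> z"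
      unfolding z_def M_def using True by (intro frac_le) auto
    then have "(real L - real r) / (3 * real n + 2 + real L + real r) \<le> 1 - z" unfolding quot by simp
    also have "1 - z \<le> exp (- z)" using exp_ge_add_one_self[of "-z"] by simp
    finally have "alt_kernel L (Suc r) \<le> exp (- z) * alt_kernel L r"
      unfolding alt_kernel_Suc[OF less_imp_le[OF True]] by (rule mult_right_mono) (rule alt_kernel_nonneg)
    also have "\<dots> \<le> exp (- z) * (alt_kernel L 0 * exp (- (real r)\<^sup>2 / M))"
      using Suc by (intro mult_left_mono) (auto simp: M_def)
    also have "\<dots> = alt_kernel L 0 * exp (- (z + (real r)\<^sup>2 / M))"
      by (simp add: exp_add exp_diff exp_minus field_simps)
    also have "z + (real r)\<^sup>2 / M = (real (Suc r))\<^sup>2 / M"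
      by (simp add: z_def power2_eq_square algebra_simps flip: add_divide_distrib)
    finally show ?thesis by (simp add: M_def)
  next
    case False
    then have "alt_kernel L (Suc r) = 0" by (simp add: alt_kernel_def)
    then show ?thesis using alt_kernel_nonneg[of L 0] by simp
  qed
qed auto

text \<open>Up to L the quotient of consecutive summands is a product of two nonnegative
  nonincreasing functions, so once below 1 it stays below 1. Beyond L the kernel is 0.\<close>

lemma alt_coef_kernel_unimodal:
  assumes "alt_coef (Suc r) * alt_kernel L (Suc r) < alt_coef r * alt_kernel L r" "r \<le> s"
  shows "alt_coef (Suc s) * alt_kernel L (Suc s) \<le> alt_coef s * alt_kernel L s"
proof (cases "s < L")
  case True
  define h where "h s = (real L - real s) / (3 * real n + 2 + real L + real s)" for s
  have step: "alt_coef (Suc s) * alt_kernel L (Suc s) = alt_coef_ratio s * h s * (alt_coef s * alt_kernel L s)" if "s \<le> L" for s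
    using that by (simp add: alt_coef_Suc alt_kernel_Suc h_def)
  have "alt_coef_ratio r * h r * (alt_coef r * alt_kernel L r) < 1 * (alt_coef r * alt_kernel L r)"
    using assms True step[of r] by simp
  then have 1: "alt_coef_ratio r * h r < 1"
    using alt_coef_pos[of r] alt_kernel_nonneg[of L r] by (meson less_eq_real_def mult_nonneg_nonneg mult_right_less_imp_less)
  have "h s \<le> h r" unfolding h_def using assms True
    by (intro frac_le) auto
  moreover have "h s \<ge> 0" using True by (simp add: h_def)
  ultimately have "alt_coef_ratio s * h s \<le> alt_coef_ratio r * h r"
    using assms alt_coef_ratio_antimono alt_coef_ratio_pos[of r] by (intro mult_mono) auto
  with 1 have "alt_coef_ratio s * h s * (alt_coef s * alt_kernel L s) \<le> 1 * (alt_coef s * alt_kernel L s)"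
    using alt_coef_pos[of s] alt_kernel_nonneg[of L s] by (intro mult_right_mono) auto
  then show ?thesis using step[of s] True by simp
next
  case False
  then have "alt_kernel L (Suc s) = 0" by (simp add: alt_kernel_def)
  then show ?thesis using alt_coef_pos[of s] alt_kernel_nonneg[of L s] by simp
qed

lemma alt_coef_le: obtains C where "\<And>r. alt_coef r \<le> C * real (r + 1) powr real n"
proof -
  define f :: "real \<Rightarrow> real \<Rightarrow> nat \<Rightarrow> complex"
    where "f x y k = pochhammer (of_real x) k / pochhammer (of_real y) k" for x y k
  have f: "f x y k = of_real (pochhammer x k / pochhammer y k)" for x y k
    by (simp add: f_def pochhammer_of_real)
  have pb: "power_bounded (f x y) (x - y)" if "y > 0" for x y
    using power_bounded_pochhammer[OF of_real_notin_nonpos_Ints[OF that], of "of_real x"] by (simp add: f_def[abs_def])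
  define a where "a = 3 * real n + 1"
  have a: "a > 0" by (simp add: a_def)
  \<comment> \<open>The four quotients contribute the exponents 3n, 1, -n - 1 and -n, in total
    n.\<close>
  have "power_bounded (\<lambda>k. f a 1 k * f (a / 2 + 1) (a / 2) k * f (real n + 1 / 2) (2 * real n + 3 / 2) k *
           f (real n + 1) (2 * real n + 1) k)
     (a - 1 + (a / 2 + 1 - a / 2) + (real n + 1 / 2 - (2 * real n + 3 / 2)) + (real n + 1 - (2 * real n + 1)))"
    by (intro power_bounded_mult pb) (use a in auto)
  also have "a - 1 + (a / 2 + 1 - a / 2) + (real n + 1 / 2 - (2 * real n + 3 / 2)) + (real n + 1 - (2 * real n + 1)) = real n"
    by (simp add: a_def)
  also have "(\<lambda>k. f a 1 k * f (a / 2 + 1) (a / 2) k * f (real n + 1 / 2) (2 * real n + 3 / 2) k *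
           f (real n + 1) (2 * real n + 1) k) = (\<lambda>k. of_real (alt_coef k))"
  proof
    fix k
    have 1: "pochhammer (a / 2 + 1) k / pochhammer (a / 2) k = (a + 2 * real k) / a"
      using a by (subst pochhammer_plus_one_quotient) (auto simp: field_simps)
    have "alt_coef k = ((a + 2 * real k) / a) * (pochhammer a k / fact k) *
        (pochhammer (real n + 1 / 2) k / pochhammer (2 * real n + 3 / 2) k) *
        (pochhammer (real n + 1) k / pochhammer (2 * real n + 1) k)"
      by (simp add: alt_coef_def a_def mult_ac)
    then show "f a 1 k * f (a / 2 + 1) (a / 2) k * f (real n + 1 / 2) (2 * real n + 3 / 2) k *
           f (real n + 1) (2 * real n + 1) k = of_real (alt_coef k)"
      unfolding f 1 of_real_mult[symmetric] by (simp add: pochhammer_fact[symmetric] mult_ac)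
  qed
  finally obtain C where "\<And>k. norm (complex_of_real (alt_coef k)) \<le> C * real (k + 1) powr real n"
    by (auto simp: power_bounded_def)
  then show ?thesis using alt_coef_pos that[of C] by (simp add: abs_of_pos)
qed

text \<open>Growth r^n of the coefficient competes with Gaussian decay of width about sqrt L; the
  maximum is therefore of order L^(n/2) relative to the kernel at r = 0.\<close>

lemma alt_coef_kernel_le:
  obtains C where "\<And>L r. alt_coef r * alt_kernel L r \<le> C * real (L + 1) powr (real n / 2) * alt_kernel L 0"
proof -
  obtain C where C': "\<And>r. alt_coef r \<le> C * real (r + 1) powr real n" using alt_coef_le by metis
  then have C: "alt_coef r \<le> C * (real r + 1) ^ n" for r
    using C'[of r] by (simp add: powr_realpow add.commute)
  have "C > 0" using C[of 0] alt_coef_pos[of 0] by simp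
  define D where "D = 2 ^ n * (2 * sqrt (fact n)) * sqrt (3 * real n + 2) ^ n"
  have D: "D > 0" unfolding D_def by (intro mult_pos_pos zero_less_power) auto
  show ?thesis
  proof (rule that[of "C * D"])
    fix L r
    define M where "M = 2 * real L + 3 * real n + 2"
    have M: "M \<ge> 1" "M > 0" by (auto simp: M_def)
    define E where "E = exp (- (real r)\<^sup>2 / M)"
    have E: "E > 0" "E \<le> 1" using M by (auto simp: E_def)
    have sq: "1 \<le> sqrt (fact n) * sqrt M ^ n"
      using M mult_mono[of 1 "sqrt (fact n)" 1 "sqrt M ^ n"] by (simp add: one_le_power)
    \<comment> \<open>Powers of r + 1 are traded for powers of r, to which
      \<open>power_exp_minus_le\<close> applies; \<open>sq\<close> absorbs the constant term. The
      comparison r + 1 <= 2r fails at r = 0, hence the case split.\<close>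
    have "(real r + 1) ^ n \<le> 2 ^ n * (1 + real r ^ n)"
    proof (cases "r = 0")
      case False
      then have "(real r + 1) ^ n \<le> (2 * real r) ^ n" by (intro power_mono) auto
      then show ?thesis by (simp add: power_mult_distrib algebra_simps)
           (smt (verit) zero_le_power)
    qed (use one_le_power[of "2 :: real" n] mult_mono[of 1 "2 ^ n :: real" 1 "1 + 0 ^ n"] in simp)
    then have "(real r + 1) ^ n * E \<le> 2 ^ n * (1 + real r ^ n) * E"
      using E by (intro mult_right_mono) auto
    also have "\<dots> = 2 ^ n * (E + real r ^ n * E)" by (simp add: algebra_simps)
    also have "\<dots> \<le> 2 ^ n * (sqrt (fact n) * sqrt M ^ n + sqrt (fact n) * sqrt M ^ n)"
    proof (intro mult_left_mono add_mono)
      show "E \<le> sqrt (fact n) * sqrt M ^ n" using E(2) sq by (rule order_trans)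
      show "real r ^ n * E \<le> sqrt (fact n) * sqrt M ^ n"
        unfolding E_def by (rule power_exp_minus_le[OF M(2)])
    qed auto
    also have "\<dots> = 2 ^ n * (2 * sqrt (fact n)) * sqrt M ^ n" by simp
    also have "sqrt M ^ n \<le> (sqrt (3 * real n + 2) * sqrt (real (L + 1))) ^ n"
    proof (intro power_mono)
      have "M \<le> (3 * real n + 2) * real (L + 1)" by (simp add: M_def algebra_simps)
      then show "sqrt M \<le> sqrt (3 * real n + 2) * sqrt (real (L + 1))"
        by (simp only: real_sqrt_mult[symmetric] real_sqrt_le_iff)
    qed (use M in auto)
    also have "2 ^ n * (2 * sqrt (fact n)) * (sqrt (3 * real n + 2) * sqrt (real (L + 1))) ^ n = D * sqrt (real (L + 1)) ^ n"
      by (simp add: D_def power_mult_distrib)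
    also have "sqrt (real (L + 1)) ^ n = real (L + 1) powr (real n / 2)"
      by (simp add: powr_half_sqrt[symmetric] powr_power powr_realpow[symmetric] powr_powr)
    finally have b: "(real r + 1) ^ n * E \<le> D * real (L + 1) powr (real n / 2)"
      by simp
    have "alt_coef r * alt_kernel L r \<le> (C * (real r + 1) ^ n) * (alt_kernel L 0 * E)"
      using alt_kernel_le[of L r] C[of r] alt_coef_pos[of r] alt_kernel_nonneg \<open>C > 0\<close>
      by (intro mult_mono) (auto simp: E_def M_def intro!: mult_nonneg_nonneg)
    also have "\<dots> = C * alt_kernel L 0 * ((real r + 1) ^ n * E)" by simp
    also have "\<dots> \<le> C * alt_kernel L 0 * (D * real (L + 1) powr (real n / 2))"
      using \<open>C > 0\<close> alt_kernel_nonneg[of L 0] by (intro mult_left_mono b) auto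
    finally show "alt_coef r * alt_kernel L r \<le> C * D * real (L + 1) powr (real n / 2) * alt_kernel L 0"
      by (simp add: mult_ac)
  qed
qed

text \<open>Unimodality bounds the alternating sum by its largest term; summing absolute values
  would cost a further factor of order sqrt L.\<close>

lemma alt_coef_kernel_alternating_le:
  obtains C where "\<And>L R. \<bar>\<Sum>r\<le>R. (-1) ^ r * (alt_coef r * alt_kernel L r)\<bar> \<le> C * real (L + 1) powr (real n / 2) * alt_kernel L 0"
proof -
  obtain C where "\<And>L r. alt_coef r * alt_kernel L r \<le> C * real (L + 1) powr (real n / 2) * alt_kernel L 0"
    using alt_coef_kernel_le by metis
  then have "\<bar>\<Sum>r\<le>R. (-1) ^ r * (alt_coef r * alt_kernel L r)\<bar> \<le> C * real (L + 1) powr (real n / 2) * alt_kernel L 0" for L R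
    by (intro abs_alternating_sum_unimodal_le)
       (auto intro: mult_nonneg_nonneg[OF less_imp_le[OF alt_coef_pos] alt_kernel_nonneg] alt_coef_kernel_unimodal)
  then show ?thesis by (rule that)
qed

end

section \<open>The two series\<close>

lemma sum_even_support:
  fixes f :: "nat \<Rightarrow> 'a :: comm_monoid_add"
  assumes "\<And>k. f (2 * k + 1) = 0"
  shows "(\<Sum>r\<le>2 * m + 1. f r) = (\<Sum>k\<le>m. f (2 * k))"
proof (induction m)
  case 0
  show ?case using assms[of 0] by simp
next
  case (Suc m)
  have "2 * Suc m + 1 = Suc (Suc (2 * m + 1))" by simp
  then show ?case using Suc assms[of "Suc m"] by simp
qed

text \<open>The weight of \<open>quadratic_5F4_sum\<close> with A = 2n + 1, placed at r = 2k so that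
  the kernel there becomes the one for a = 2A = 4n + 2 at index r.\<close>

definition even_coef :: "nat \<Rightarrow> nat \<Rightarrow> real" where
  "even_coef n r = (if even r then (2 * real n + 1 + real r) *
     (pochhammer (2 * real n + 1) (r div 2) / ((2 * real n + 1) * fact (r div 2))) else 0)"

definition bailey_beta :: "nat \<Rightarrow> nat \<Rightarrow> complex" where
  "bailey_beta n L = pochhammer (of_nat n + 1 / 2) L /
     (fact L * pochhammer (2 * of_nat n + 1) L * pochhammer (2 * of_nat n + 3 / 2) L)"

lemma of_real_alt_coef:
  "complex_of_real (alt_coef n r) = (3 * of_nat n + 1 + 2 * of_nat r) *
     (pochhammer (3 * of_nat n + 1) r * pochhammer (of_nat n + 1 / 2) r * pochhammer (of_nat n + 1) r /
      ((3 * of_nat n + 1) * fact r * pochhammer (2 * of_nat n + 3 / 2) r * pochhammer (2 * of_nat n + 1) r))"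
  by (simp add: alt_coef_def pochhammer_of_real[symmetric])

lemma of_real_alt_kernel: "complex_of_real (alt_kernel n L r) = bailey_kernel (3 * of_nat n + 1) L r"
  by (simp add: alt_kernel_def bailey_kernel_def pochhammer_of_real[symmetric] add.assoc)

lemma alt_coef_sum:
  "(\<Sum>r\<le>L. complex_of_real ((-1) ^ r * alt_coef n r) * bailey_kernel (3 * of_nat n + 1) L r) = bailey_beta n L"
proof -
  have "3 * of_nat n + 1 + 1 \<notin> (\<int>\<^sub>\<le>\<^sub>0 :: complex set)" "3 * of_nat n + 1 + 1 - (of_nat n + 1 / 2) \<notin> (\<int>\<^sub>\<le>\<^sub>0 :: complex set)"
    "3 * of_nat n + 1 + 1 - (of_nat n + 1) \<notin> (\<int>\<^sub>\<le>\<^sub>0 :: complex set)" "3 * of_nat n + 1 \<noteq> (0 :: complex)"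
    using of_real_notin_nonpos_Ints[of "3 * real n + 1 + 1"] of_real_notin_nonpos_Ints[of "3 * real n + 1 + 1 - (real n + 1 / 2)"]
      of_real_notin_nonpos_Ints[of "3 * real n + 1 + 1 - (real n + 1)"] of_real_notin_nonpos_Ints[of "3 * real n + 1"]
    by auto
  \<comment> \<open>Here b = n + 1/2 and e = n + 1, so a + 1 - b - e = n + 1/2 as well.\<close>
  note * = well_poised_5F4_sum[OF this(1,4,2,3), of L]
  have eq: "3 * of_nat n + 1 + 1 - (of_nat n + 1 / 2) = (2 * of_nat n + 3 / 2 :: complex)"
      "3 * of_nat n + 1 + 1 - (of_nat n + 1) = (2 * of_nat n + 1 :: complex)"
      "2 * of_nat n + 3 / 2 - (of_nat n + 1) = (of_nat n + 1 / 2 :: complex)"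
    by simp_all
  show ?thesis
    using * unfolding eq by (simp add: of_real_alt_coef bailey_beta_def mult_ac)
qed

lemma even_coef_sum:
  "(\<Sum>r\<le>L. complex_of_real (even_coef n r) * bailey_kernel (4 * of_nat n + 2) L r) = bailey_beta n L"
proof -
  let ?A = "2 * of_nat n + 1 :: complex"
  have A2: "2 * ?A = 4 * of_nat n + 2" by simp
  have "2 * ?A \<notin> \<int>\<^sub>\<le>\<^sub>0" using of_real_notin_nonpos_Ints[of "4 * real n + 2"] by simp
  note * = quadratic_5F4_sum[OF this, of L]
  \<comment> \<open>The kernel is 0 on the added indices, and the longer range consists of complete
    even-odd pairs.\<close>
  have "(\<Sum>r\<le>L. complex_of_real (even_coef n r) * bailey_kernel (4 * of_nat n + 2) L r) =
        (\<Sum>r\<le>2 * L + 1. complex_of_real (even_coef n r) * bailey_kernel (4 * of_nat n + 2) L r)"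
    by (intro sum.mono_neutral_left) (auto simp: bailey_kernel_def)
  also have "\<dots> = (\<Sum>k\<le>L. complex_of_real (even_coef n (2 * k)) * bailey_kernel (4 * of_nat n + 2) L (2 * k))"
    by (rule sum_even_support) (simp add: even_coef_def)
  also have "\<dots> = (\<Sum>k\<le>L. (?A + 2 * of_nat k) * (pochhammer ?A k / (?A * fact k)) * bailey_kernel (4 * of_nat n + 2) L (2 * k))"
    by (simp add: even_coef_def pochhammer_of_real[symmetric])
  also have "\<dots> = pochhammer (?A / 2) L / (fact L * pochhammer ?A L * pochhammer (?A + 1 / 2) L)"
    using * unfolding A2 .
  also have "?A / 2 = of_nat n + 1 / 2" by (simp add: field_simps)
  also have "?A + 1 / 2 = 2 * of_nat n + 3 / 2" by simp
  finally show ?thesis by (simp add: bailey_beta_def)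
qed

text \<open>All summands are nonnegative, so the partial sums increase until they reach the value
  \<open>bailey_beta n L\<close> at R = L.\<close>

lemma norm_even_coef_partial_sum_le:
  "norm (\<Sum>r\<le>R. complex_of_real (even_coef n r) * bailey_kernel (4 * of_nat n + 2) L r) \<le> norm (bailey_beta n L)"
proof -
  define p where "p r = even_coef n r * (if r \<le> L then 1 / (fact (L - r) * pochhammer (4 * real n + 3) (L + r)) else 0)" for r
  have p: "complex_of_real (even_coef n r) * bailey_kernel (4 * of_nat n + 2) L r = of_real (p r)" for r
    by (simp add: p_def bailey_kernel_def pochhammer_of_real[symmetric] add.assoc)
  have nonneg: "p r \<ge> 0" for r
    by (auto simp: p_def even_coef_def intro!: mult_nonneg_nonneg divide_nonneg_nonneg pochhammer_nonneg_of_nonneg)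
  have "(\<Sum>r\<le>R. p r) \<le> (\<Sum>r\<le>max L R. p r)"
    by (intro sum_mono2) (use nonneg in auto)
  also have "\<dots> = (\<Sum>r\<le>L. p r)"
    by (intro sum.mono_neutral_right) (auto simp: p_def)
  finally have "(\<Sum>r\<le>R. p r) \<le> (\<Sum>r\<le>L. p r)" .
  then show ?thesis
    unfolding even_coef_sum[symmetric] p of_real_sum[symmetric] norm_of_real
    using nonneg by (simp add: sum_nonneg)
qed

text \<open>The summands have order k^(2 Re (c + d) - 5n - 4) in modulus and must tend to 0. The
  lower bound on their size is obtained as an upper bound for the reciprocals \<open>I\<close>,
  which exist because (c)_k and (d)_k never vanish.\<close>

lemma Re_less_if_hypergeom_convergent:
  fixes n :: nat and c d :: complex
  assumes conv: "hypergeom_convergent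
       [3 * of_nat n + 1, 3 * of_nat n / 2 + 3 / 2, of_nat n + 1 / 2, of_nat n + 1, c, d]
       [3 * of_nat n / 2 + 1 / 2, 2 * of_nat n + 3 / 2, 2 * of_nat n + 1,
        3 * of_nat n + 2 - c, 3 * of_nat n + 2 - d] (- 1)"
    and cd: "c \<notin> \<int>\<^sub>\<le>\<^sub>0" "d \<notin> \<int>\<^sub>\<le>\<^sub>0"
  shows "Re (c + d) < 5 * real n / 2 + 2"
proof (rule ccontr)
  assume ge: "\<not> Re (c + d) < 5 * real n / 2 + 2"
  let ?q = "\<lambda>x y k. pochhammer x k / pochhammer y k :: complex"
  define T where "T = hypergeom_term
       [3 * of_nat n + 1, 3 * of_nat n / 2 + 3 / 2, of_nat n + 1 / 2, of_nat n + 1, c, d]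
       [3 * of_nat n / 2 + 1 / 2, 2 * of_nat n + 3 / 2, 2 * of_nat n + 1,
        3 * of_nat n + 2 - c, 3 * of_nat n + 2 - d] (- 1)"
  define I where "I k = ?q 1 (3 * of_nat n + 1) k * ?q (3 * of_nat n / 2 + 1 / 2) (3 * of_nat n / 2 + 3 / 2) k *
      ?q (2 * of_nat n + 3 / 2) (of_nat n + 1 / 2) k * ?q (2 * of_nat n + 1) (of_nat n + 1) k *
      ?q (3 * of_nat n + 2 - c) c k * ?q (3 * of_nat n + 2 - d) d k" for k
  have pos: "3 * of_nat n + 1 \<notin> (\<int>\<^sub>\<le>\<^sub>0 :: complex set)" "3 * of_nat n / 2 + 3 / 2 \<notin> (\<int>\<^sub>\<le>\<^sub>0 :: complex set)"
    "of_nat n + 1 / 2 \<notin> (\<int>\<^sub>\<le>\<^sub>0 :: complex set)" "of_nat n + 1 \<notin> (\<int>\<^sub>\<le>\<^sub>0 :: complex set)"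
    using of_real_notin_nonpos_Ints[of "3 * real n + 1"] of_real_notin_nonpos_Ints[of "3 * real n / 2 + 3 / 2"]
      of_real_notin_nonpos_Ints[of "real n + 1 / 2"] of_real_notin_nonpos_Ints[of "real n + 1"] by auto
  have lower: "b \<notin> \<int>\<^sub>\<le>\<^sub>0" if "b \<in> set [3 * of_nat n / 2 + 1 / 2, 2 * of_nat n + 3 / 2, 2 * of_nat n + 1,
        3 * of_nat n + 2 - c, 3 * of_nat n + 2 - d]" for b
    using conv that unfolding hypergeom_convergent_def by blast
  have "power_bounded I (Re (1 - (3 * of_nat n + 1)) + Re (3 * of_nat n / 2 + 1 / 2 - (3 * of_nat n / 2 + 3 / 2)) +
     Re (2 * of_nat n + 3 / 2 - (of_nat n + 1 / 2)) + Re (2 * of_nat n + 1 - (of_nat n + 1)) +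
     Re (3 * of_nat n + 2 - c - c) + Re (3 * of_nat n + 2 - d - d))"
    unfolding I_def by (intro power_bounded_mult power_bounded_pochhammer pos cd)
  then obtain C where C: "\<And>k. norm (I k) \<le> C * real (k + 1) powr (5 * real n + 4 - 2 * Re (c + d))"
    unfolding power_bounded_def by (auto simp: algebra_simps)
  have TI: "norm (T k) * norm (I k) = 1" for k
  proof -
    have nz: "pochhammer x k \<noteq> 0" if "x \<notin> \<int>\<^sub>\<le>\<^sub>0" for x :: complex
      using that pochhammer_eq_0_imp_nonpos_Int by blast
    have "pochhammer 1 k = (fact k :: complex)" by (simp add: pochhammer_fact)
    then have "T k * I k = (- 1) ^ k"
      using nz[OF pos(1)] nz[OF pos(2)] nz[OF pos(3)] nz[OF pos(4)] nz[OF cd(1)] nz[OF cd(2)]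
        lower[THEN nz] by (simp add: T_def I_def hypergeom_term_altdef field_simps)
    then show ?thesis by (metis norm_mult norm_power norm_minus_cancel norm_one power_one)
  qed
  have "1 \<le> C * norm (T k)" for k
  proof -
    have "norm (I k) \<le> C * real (k + 1) powr (5 * real n + 4 - 2 * Re (c + d))" by (rule C)
    also have "\<dots> \<le> C * 1"
    proof (intro mult_left_mono)
      have "real (k + 1) powr (5 * real n + 4 - 2 * Re (c + d)) \<le> real (k + 1) powr 0"
        using ge by (intro powr_mono) auto
      then show "real (k + 1) powr (5 * real n + 4 - 2 * Re (c + d)) \<le> 1" by simp
      show "C \<ge> 0" using order_trans[OF norm_ge_zero C[of 0]] by simp
    qed
    finally have "norm (T k) * norm (I k) \<le> norm (T k) * C" by (intro mult_left_mono) auto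
    then show ?thesis unfolding TI by (simp only: mult.commute)
  qed
  moreover have "T \<longlonglongrightarrow> 0"
    using conv unfolding hypergeom_convergent_def T_def by (intro summable_LIMSEQ_zero) auto
  then have "(\<lambda>k. C * norm (T k)) \<longlonglongrightarrow> C * 0"
    by (intro tendsto_mult tendsto_const tendsto_norm_zero)
  ultimately have "1 \<le> C * (0 :: real)"
    by (intro LIMSEQ_le_const) auto
  then show False by simp
qed

section \<open>The hypergeometric summands in terms of the coefficient sequences\<close>

lemma hypergeom_term_eq_alt_coef:
  fixes c d :: complex
  shows "hypergeom_term
     [3 * of_nat n + 1, 3 * of_nat n / 2 + 3 / 2, of_nat n + 1 / 2, of_nat n + 1, c, d]
     [3 * of_nat n / 2 + 1 / 2, 2 * of_nat n + 3 / 2, 2 * of_nat n + 1,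
      3 * of_nat n + 2 - c, 3 * of_nat n + 2 - d] (- 1) k =
    of_real ((-1) ^ k * alt_coef n k) *
     (pochhammer c k * pochhammer d k / (pochhammer (3 * of_nat n + 2 - c) k * pochhammer (3 * of_nat n + 2 - d) k))"
proof -
  let ?u = "3 * of_nat n / 2 + 1 / 2 :: complex"
  have u: "?u \<notin> \<int>\<^sub>\<le>\<^sub>0" using of_real_notin_nonpos_Ints[of "3 * real n / 2 + 1 / 2"] by simp
  \<comment> \<open>The very-well-poised pair a/2 + 1 over a/2 with a = 3n + 1.\<close>
  have one: "3 * of_nat n / 2 + 3 / 2 = ?u + 1" by simp
  have "pochhammer (3 * of_nat n / 2 + 3 / 2) k / pochhammer ?u k = (?u + of_nat k) / ?u"
    unfolding one by (rule pochhammer_plus_one_quotient) (use u plus_of_nat_eq_0_imp in blast)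
  also have "\<dots> = (2 * (?u + of_nat k)) / (2 * ?u)" by (rule mult_divide_mult_cancel_left[symmetric]) simp
  also have "\<dots> = (3 * of_nat n + 1 + 2 * of_nat k) / (3 * of_nat n + 1)" by (simp add: algebra_simps)
  finally have q: "pochhammer (3 * of_nat n / 2 + 3 / 2) k / pochhammer ?u k = (3 * of_nat n + 1 + 2 * of_nat k) / (3 * of_nat n + 1 :: complex)" .
  have "hypergeom_term
     [3 * of_nat n + 1, 3 * of_nat n / 2 + 3 / 2, of_nat n + 1 / 2, of_nat n + 1, c, d]
     [3 * of_nat n / 2 + 1 / 2, 2 * of_nat n + 3 / 2, 2 * of_nat n + 1,
      3 * of_nat n + 2 - c, 3 * of_nat n + 2 - d] (- 1) k =
    (pochhammer (3 * of_nat n / 2 + 3 / 2) k / pochhammer ?u k) *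
    ((- 1) ^ k * (pochhammer (3 * of_nat n + 1) k * pochhammer (of_nat n + 1 / 2) k * pochhammer (of_nat n + 1) k /
      (fact k * pochhammer (2 * of_nat n + 3 / 2) k * pochhammer (2 * of_nat n + 1) k)) *
     (pochhammer c k * pochhammer d k / (pochhammer (3 * of_nat n + 2 - c) k * pochhammer (3 * of_nat n + 2 - d) k)))"
    unfolding hypergeom_term_altdef by (simp add: mult_ac)
  then show ?thesis
    unfolding q of_real_mult of_real_alt_coef by (simp add: mult_ac)
qed

lemma hypergeom_term_eq_even_coef:
  fixes c d :: complex
  shows "hypergeom_term
     [2 * of_nat n + 1, of_nat n + 3 / 2, c / 2, c / 2 + 1 / 2, d / 2, d / 2 + 1 / 2]
     [of_nat n + 1 / 2, 2 * of_nat n + 2 - c / 2, 2 * of_nat n + 3 / 2 - c / 2,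
      2 * of_nat n + 2 - d / 2, 2 * of_nat n + 3 / 2 - d / 2] 1 k =
     of_real (even_coef n (2 * k)) *
     (pochhammer c (2 * k) * pochhammer d (2 * k) / (pochhammer (4 * of_nat n + 3 - c) (2 * k) * pochhammer (4 * of_nat n + 3 - d) (2 * k)))"
proof -
  let ?u = "of_nat n + 1 / 2 :: complex"
  have u: "?u \<notin> \<int>\<^sub>\<le>\<^sub>0" using of_real_notin_nonpos_Ints[of "real n + 1 / 2"] by simp
  have one: "of_nat n + 3 / 2 = ?u + 1" by simp
  have "pochhammer (of_nat n + 3 / 2) k / pochhammer ?u k = (?u + of_nat k) / ?u"
    unfolding one by (rule pochhammer_plus_one_quotient) (use u plus_of_nat_eq_0_imp in blast)
  also have "\<dots> = (2 * (?u + of_nat k)) / (2 * ?u)" by (rule mult_divide_mult_cancel_left[symmetric]) simp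
  also have "\<dots> = (2 * of_nat n + 1 + of_nat (2 * k)) / (2 * of_nat n + 1)" by (simp add: algebra_simps)
  finally have q: "pochhammer (of_nat n + 3 / 2) k / pochhammer ?u k = (2 * of_nat n + 1 + of_nat (2 * k)) / (2 * of_nat n + 1 :: complex)" .
  \<comment> \<open>Each pair v/2, v/2 + 1/2 merges into (v)_(2k); the powers of 4 cancel between
    the two upper and the two lower pairs.\<close>
  have double: "pochhammer v (2 * k) = of_nat (2 ^ (2 * k)) * (pochhammer (v / 2) k * pochhammer (v / 2 + 1 / 2) k)" for v :: complex
    using pochhammer_double[of "v / 2" k] by (simp add: mult_ac)
  have lower: "(4 * of_nat n + 3 - v) / 2 + 1 / 2 = 2 * of_nat n + 2 - v / 2"
    "(4 * of_nat n + 3 - v) / 2 = 2 * of_nat n + 3 / 2 - v / 2" for v :: complex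
    by (simp_all add: field_simps)
  have "hypergeom_term
     [2 * of_nat n + 1, of_nat n + 3 / 2, c / 2, c / 2 + 1 / 2, d / 2, d / 2 + 1 / 2]
     [of_nat n + 1 / 2, 2 * of_nat n + 2 - c / 2, 2 * of_nat n + 3 / 2 - c / 2,
      2 * of_nat n + 2 - d / 2, 2 * of_nat n + 3 / 2 - d / 2] 1 k =
     (pochhammer (of_nat n + 3 / 2) k / pochhammer ?u k) * (pochhammer (2 * of_nat n + 1) k / fact k *
     (pochhammer c (2 * k) * pochhammer d (2 * k) / (pochhammer (4 * of_nat n + 3 - c) (2 * k) * pochhammer (4 * of_nat n + 3 - d) (2 * k))))"
    unfolding hypergeom_term_altdef double lower by (simp add: mult_ac add_ac add_diff_eq)
  then show ?thesis
    unfolding q by (simp add: even_coef_def pochhammer_of_real[symmetric] mult_ac)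
qed

theorem theorem2:
  fixes n :: nat and c d :: complex
  assumes lhs_convergent:
    "hypergeom_convergent
       [3 * of_nat n + 1, 3 * of_nat n / 2 + 3 / 2, of_nat n + 1 / 2, of_nat n + 1, c, d]
       [3 * of_nat n / 2 + 1 / 2, 2 * of_nat n + 3 / 2, 2 * of_nat n + 1,
        3 * of_nat n + 2 - c, 3 * of_nat n + 2 - d]
       (- 1)"
  and rhs_convergent:
    "hypergeom_convergent
       [2 * of_nat n + 1, of_nat n + 3 / 2, c / 2, c / 2 + 1 / 2, d / 2, d / 2 + 1 / 2]
       [of_nat n + 1 / 2, 2 * of_nat n + 2 - c / 2, 2 * of_nat n + 3 / 2 - c / 2,
        2 * of_nat n + 2 - d / 2, 2 * of_nat n + 3 / 2 - d / 2]
       1"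
  and Gamma_defined:
    "3 * of_nat n + 2 - c \<notin> \<int>\<^sub>\<le>\<^sub>0"
    "3 * of_nat n + 2 - d \<notin> \<int>\<^sub>\<le>\<^sub>0"
    "4 * of_nat n + 3 - c - d \<notin> \<int>\<^sub>\<le>\<^sub>0"
    "4 * of_nat n + 3 - c \<notin> \<int>\<^sub>\<le>\<^sub>0"
    "4 * of_nat n + 3 - d \<notin> \<int>\<^sub>\<le>\<^sub>0"
    "3 * of_nat n + 2 - c - d \<notin> \<int>\<^sub>\<le>\<^sub>0"
  shows
    "hypergeom
       [3 * of_nat n + 1, 3 * of_nat n / 2 + 3 / 2, of_nat n + 1 / 2, of_nat n + 1, c, d]
       [3 * of_nat n / 2 + 1 / 2, 2 * of_nat n + 3 / 2, 2 * of_nat n + 1,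
        3 * of_nat n + 2 - c, 3 * of_nat n + 2 - d]
       (- 1) =
     (Gamma (4 * of_nat n + 3) * Gamma (3 * of_nat n + 2 - c) * Gamma (3 * of_nat n + 2 - d) *
        Gamma (4 * of_nat n + 3 - c - d)) /
     (Gamma (3 * of_nat n + 2) * Gamma (4 * of_nat n + 3 - c) * Gamma (4 * of_nat n + 3 - d) *
        Gamma (3 * of_nat n + 2 - c - d)) *
     hypergeom
       [2 * of_nat n + 1, of_nat n + 3 / 2, c / 2, c / 2 + 1 / 2, d / 2, d / 2 + 1 / 2]
       [of_nat n + 1 / 2, 2 * of_nat n + 2 - c / 2, 2 * of_nat n + 3 / 2 - c / 2,
        2 * of_nat n + 2 - d / 2, 2 * of_nat n + 3 / 2 - d / 2]
       1"
proof -
  define X where "X = (\<Sum>L. pochhammer c L * pochhammer d L * bailey_beta n L)"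
  have re: "Re (c + d) < 5 * real n / 2 + 2" if "c \<notin> \<int>\<^sub>\<le>\<^sub>0" "d \<notin> \<int>\<^sub>\<le>\<^sub>0"
    using Re_less_if_hypergeom_convergent[OF lhs_convergent that] .
  have ev: "eventually (\<lambda>L. pochhammer c L * pochhammer d L = 0) sequentially" if "c \<in> \<int>\<^sub>\<le>\<^sub>0 \<or> d \<in> \<int>\<^sub>\<le>\<^sub>0"
    using that by (auto dest!: pochhammer_eventually_0 elim!: eventually_mono)
  \<comment> \<open>If c or d is a nonpositive integer, all but finitely many weights are 0 and any
    majorant is summable; the bound \<open>re\<close> is available only in the other case.\<close>
  have trivial: "summable (\<lambda>L. norm (pochhammer c L * pochhammer d L) * B L)" if "c \<in> \<int>\<^sub>\<le>\<^sub>0 \<or> d \<in> \<int>\<^sub>\<le>\<^sub>0" for B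
  proof -
    have "eventually (\<lambda>L. norm (pochhammer c L * pochhammer d L) * B L = 0) sequentially"
      using ev[OF that] by eventually_elim simp
    then show ?thesis using summable_cong[of _ "\<lambda>_. 0 :: real"] by auto
  qed
  have notin3: "3 * of_nat n + 2 \<notin> (\<int>\<^sub>\<le>\<^sub>0 :: complex set)" and notin4: "4 * of_nat n + 3 \<notin> (\<int>\<^sub>\<le>\<^sub>0 :: complex set)"
    using of_real_notin_nonpos_Ints[of "3 * real n + 2"] of_real_notin_nonpos_Ints[of "4 * real n + 3"] by auto
  have eq3: "3 * of_nat n + 1 + 1 = (3 * of_nat n + 2 :: complex)" and eq4: "4 * of_nat n + 2 + 1 = (4 * of_nat n + 3 :: complex)"
    by simp_all

  obtain C where C: "\<And>L R. \<bar>\<Sum>r\<le>R. (-1) ^ r * (alt_coef n r * alt_kernel n L r)\<bar> \<le> C * real (L + 1) powr (real n / 2) * alt_kernel n L 0"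
    using alt_coef_kernel_alternating_le by metis
  have "summable (\<lambda>L. norm (pochhammer c L * pochhammer d L) * (C * real (L + 1) powr (real n / 2) * alt_kernel n L 0))"
  proof (cases "c \<in> \<int>\<^sub>\<le>\<^sub>0 \<or> d \<in> \<int>\<^sub>\<le>\<^sub>0")
    case False
    have "power_bounded (\<lambda>L. of_real (real (L + 1) powr (real n / 2))) (real n / 2)"
      unfolding power_bounded_def by (rule exI[of _ 1]) simp
    \<comment> \<open>The exponent Re (c + d) - (3n + 2) - 1 + n/2 is below -1 exactly when Re (c +
      d) < 5n/2 + 2, which is the bound \<open>re\<close> forced by convergence of the left-hand
      series.\<close>
    then have "summable (\<lambda>L. norm (gauss_term c d (3 * of_nat n + 2) L * of_real (real (L + 1) powr (real n / 2))))"
      by (intro power_bounded_summable[OF power_bounded_mult[OF power_bounded_gauss_term[OF notin3]]])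
         (use re False in auto)
    then have "summable (\<lambda>L. C * norm (gauss_term c d (3 * of_nat n + 2) L * of_real (real (L + 1) powr (real n / 2))))"
      by (rule summable_mult)
    also have "(\<lambda>L. C * norm (gauss_term c d (3 * of_nat n + 2) L * of_real (real (L + 1) powr (real n / 2)))) =
       (\<lambda>L. norm (pochhammer c L * pochhammer d L) * (C * real (L + 1) powr (real n / 2) * alt_kernel n L 0))"
    proof
      fix L
      have "norm (pochhammer (3 * of_nat n + 2 :: complex) L) = pochhammer (3 * real n + 2) L"
        using pochhammer_of_real[of "3 * real n + 2" L, where 'a = complex] pochhammer_nonneg_of_nonneg[of "3 * real n + 2" L] by simp
      then show "C * norm (gauss_term c d (3 * of_nat n + 2) L * of_real (real (L + 1) powr (real n / 2))) =
          norm (pochhammer c L * pochhammer d L) * (C * real (L + 1) powr (real n / 2) * alt_kernel n L 0)"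
        by (simp add: gauss_term_def alt_kernel_def norm_mult norm_divide mult_ac)
    qed
    finally show ?thesis .
  qed (rule trivial)
  note summable1 = this
  have bound1: "norm (\<Sum>r\<le>R. complex_of_real ((-1) ^ r * alt_coef n r) * bailey_kernel (3 * of_nat n + 1) L r) \<le>
      C * real (L + 1) powr (real n / 2) * alt_kernel n L 0" for L R
    using C[of L R] unfolding of_real_alt_kernel[symmetric] of_real_mult[symmetric] of_real_sum[symmetric] norm_of_real mult.assoc .
  \<comment> \<open>Both admissibility facts follow from 5n/2 + 2 <= 3n + 2 <= 4n + 3 in the
    nonterminating case.\<close>
  have adm1: "gauss_admissible c d (3 * of_nat n + 2)"
    using re unfolding gauss_admissible_def by fastforce
  have adm2: "gauss_admissible c d (4 * of_nat n + 3)"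
    using re unfolding gauss_admissible_def by fastforce
  have sums1: "(\<lambda>r. complex_of_real ((-1) ^ r * alt_coef n r) *
       (pochhammer c r * pochhammer d r / (pochhammer (3 * of_nat n + 2 - c) r * pochhammer (3 * of_nat n + 2 - d) r))) sums
     (Gamma (3 * of_nat n + 2 - c) * Gamma (3 * of_nat n + 2 - d) / (Gamma (3 * of_nat n + 2) * Gamma (3 * of_nat n + 2 - c - d)) * X)"
    using bailey_transform[of "3 * of_nat n + 1" c d "bailey_beta n" "\<lambda>r. complex_of_real ((-1) ^ r * alt_coef n r)",
        OF _ _ _ _ _ alt_coef_sum[symmetric] bound1 summable1]
    unfolding eq3 X_def using Gamma_defined notin3 adm1 by blast

  have "summable (\<lambda>L. norm (pochhammer c L * pochhammer d L) * norm (bailey_beta n L))"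
  proof (cases "c \<in> \<int>\<^sub>\<le>\<^sub>0 \<or> d \<in> \<int>\<^sub>\<le>\<^sub>0")
    case False
    have pos: "2 * of_nat n + 1 \<notin> (\<int>\<^sub>\<le>\<^sub>0 :: complex set)" "2 * of_nat n + 3 / 2 \<notin> (\<int>\<^sub>\<le>\<^sub>0 :: complex set)"
      using of_real_notin_nonpos_Ints[of "2 * real n + 1"] of_real_notin_nonpos_Ints[of "2 * real n + 3 / 2"] by auto
    \<comment> \<open>Here the exponent is Re (c + d) - 3n - 3, which \<open>re\<close> makes
      smaller than -n/2 - 1.\<close>
    have "summable (\<lambda>L. norm (gauss_term c d (2 * of_nat n + 1) L *
        (pochhammer (of_nat n + 1 / 2) L / pochhammer (2 * of_nat n + 3 / 2) L)))"
      by (rule power_bounded_summable[OF power_bounded_mult[OF power_bounded_gauss_term[OF pos(1)] power_bounded_pochhammer[OF pos(2)]]])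
         (use re False in auto)
    also have "(\<lambda>L. norm (gauss_term c d (2 * of_nat n + 1) L *
        (pochhammer (of_nat n + 1 / 2) L / pochhammer (2 * of_nat n + 3 / 2) L))) =
        (\<lambda>L. norm (pochhammer c L * pochhammer d L) * norm (bailey_beta n L))"
      by (simp add: gauss_term_def bailey_beta_def norm_mult norm_divide mult_ac)
    finally show ?thesis .
  qed (rule trivial)
  note summable2 = this
  have sums2: "(\<lambda>r. complex_of_real (even_coef n r) *
       (pochhammer c r * pochhammer d r / (pochhammer (4 * of_nat n + 3 - c) r * pochhammer (4 * of_nat n + 3 - d) r))) sums
     (Gamma (4 * of_nat n + 3 - c) * Gamma (4 * of_nat n + 3 - d) / (Gamma (4 * of_nat n + 3) * Gamma (4 * of_nat n + 3 - c - d)) * X)"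
    using bailey_transform[of "4 * of_nat n + 2" c d "bailey_beta n" "\<lambda>r. complex_of_real (even_coef n r)",
        OF _ _ _ _ _ even_coef_sum[symmetric] norm_even_coef_partial_sum_le summable2]
    unfolding eq4 X_def using Gamma_defined notin4 adm2 by blast
  have sums2': "(\<lambda>k. complex_of_real (even_coef n (2 * k)) *
       (pochhammer c (2 * k) * pochhammer d (2 * k) / (pochhammer (4 * of_nat n + 3 - c) (2 * k) * pochhammer (4 * of_nat n + 3 - d) (2 * k)))) sums
     (Gamma (4 * of_nat n + 3 - c) * Gamma (4 * of_nat n + 3 - d) / (Gamma (4 * of_nat n + 3) * Gamma (4 * of_nat n + 3 - c - d)) * X)"
  proof (subst sums_mono_reindex[where g = "\<lambda>k. 2 * k"])
    show "strict_mono (\<lambda>k. 2 * k :: nat)" by (simp add: strict_mono_def)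
    fix r :: nat assume "r \<notin> range (\<lambda>k. 2 * k)"
    then have "odd r" by (auto elim!: evenE)
    then show "complex_of_real (even_coef n r) *
       (pochhammer c r * pochhammer d r / (pochhammer (4 * of_nat n + 3 - c) r * pochhammer (4 * of_nat n + 3 - d) r)) = 0"
      by (simp add: even_coef_def)
  qed (rule sums2)

  have "hypergeom
       [3 * of_nat n + 1, 3 * of_nat n / 2 + 3 / 2, of_nat n + 1 / 2, of_nat n + 1, c, d]
       [3 * of_nat n / 2 + 1 / 2, 2 * of_nat n + 3 / 2, 2 * of_nat n + 1,
        3 * of_nat n + 2 - c, 3 * of_nat n + 2 - d] (- 1) =
      Gamma (3 * of_nat n + 2 - c) * Gamma (3 * of_nat n + 2 - d) / (Gamma (3 * of_nat n + 2) * Gamma (3 * of_nat n + 2 - c - d)) * X"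
    unfolding hypergeom_def hypergeom_term_eq_alt_coef sums1[THEN sums_unique] ..
  moreover have "hypergeom
       [2 * of_nat n + 1, of_nat n + 3 / 2, c / 2, c / 2 + 1 / 2, d / 2, d / 2 + 1 / 2]
       [of_nat n + 1 / 2, 2 * of_nat n + 2 - c / 2, 2 * of_nat n + 3 / 2 - c / 2,
        2 * of_nat n + 2 - d / 2, 2 * of_nat n + 3 / 2 - d / 2] 1 =
      Gamma (4 * of_nat n + 3 - c) * Gamma (4 * of_nat n + 3 - d) / (Gamma (4 * of_nat n + 3) * Gamma (4 * of_nat n + 3 - c - d)) * X"
    unfolding hypergeom_def hypergeom_term_eq_even_coef sums2'[THEN sums_unique] ..
  \<comment> \<open>These factors are nonzero, so \<open>X\<close> can be eliminated between the two
    evaluations.\<close>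
  moreover have "Gamma (3 * of_nat n + 2 - c - d) \<noteq> 0" "Gamma (4 * of_nat n + 3 - c) \<noteq> 0"
      "Gamma (4 * of_nat n + 3 - d) \<noteq> 0" "Gamma (4 * of_nat n + 3 - c - d) \<noteq> 0"
      "Gamma (4 * of_nat n + 3 :: complex) \<noteq> 0"
    using Gamma_defined notin4 by (simp_all add: Gamma_eq_zero_iff)
  ultimately show ?thesis by simp
qed

end
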